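(* Let $\mathfrak{g}$ be a Lie algebra and $\Sigma$ a subgroup of its outer automorphism group $\mathrm{Out}(\mathfrak{g})$. Assume that $\mathfrak{g}$ is $\Sigma$-simple, with canonical decomposition $$\mathfrak{g}=\mathfrak{g}_s\oplus\ldots\oplus\mathfrak{g}_s\quad(n\text{ summands})$$ into the direct sum of $n$ copies of the same simple Lie algebra $\mathfrak{g}_s$, and let $\mathfrak{m}$ be a $\Sigma$-primitive subalgebra of $\mathfrak{g}$. Then one of the following two alternatives holds. 1. (Simple type) Up to ``twisting'' with an appropriate automorphism of $\mathfrak{g}$, $\mathfrak{m}$ is the direct sum of $n$ copies of the same $\Sigma_s$-primitive subalgebra $\mathfrak{m}_s$ of $\mathfrak{g}_s$: $$\mathfrak{m}=\mathfrak{m}_s\oplus\ldots\oplus\mathfrak{m}_s\quad(n\text{ summands}),$$ where the subgroup $\Sigma_s$ of $\mathrm{Out}(\mathfrak{g}_s)$ is obtained from the subgroup $\Sigma$ of $\mathrm{Out}(\mathfrak{g})$ by projection. 2. (Diagonal type) Up to ``twisting'' with an appropriate automorphism of $\mathfrak{g}$, $\mathfrak{m}$ is the direct sum of a certain number $q$ of copies of the diagonal subalgebra of the direct sum of a certain number $p$ of copies of $\mathfrak{g}_s$: $$\mathfrak{m}=\mathrm{diag}_p\,\mathfrak{g}_s\oplus\ldots\oplus\mathrm{diag}_p\,\mathfrak{g}_s\quad(q\text{ summands}),\qquad \mathrm{diag}_p\,\mathfrak{g}_s=\{(X_s,\ldots,X_s)\mid X_s\in\mathfrak{g}_s\}\quad(p\text{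 entries}),$$ where $p$ and $q$ are divisors of $n$ (with $pq=n$), $p>1$ and $q<n$, chosen such that $p$ is the minimum and $q$ the maximum possible value for which the resulting partition $$\{1,\ldots,n\}=\bigl\{\{1,\ldots,p\},\ldots,\{n-p+1,\ldots,n\}\bigr\}$$ is $\Sigma$-invariant.
   Context: All Lie algebras are finite-dimensional. $\mathrm{Inn}(\mathfrak{g})$ is the group of inner automorphisms ($=\mathrm{Ad}(G_0)$ for a connected Lie group $G_0$ with Lie algebra $\mathfrak{g}$), $\mathrm{Out}(\mathfrak{g})=\mathrm{Aut}(\mathfrak{g})/\mathrm{Inn}(\mathfrak{g})$. For $\Sigma\subset\mathrm{Out}(\mathfrak{g})$, $\mathrm{Aut}_\Sigma(\mathfrak{g})$ is the inverse image of $\Sigma$ in $\mathrm{Aut}(\mathfrak{g})$, and $\mathrm{Aut}_\Sigma(\mathfrak{g},\mathfrak{h})=\{\phi\in\mathrm{Aut}_\Sigma(\mathfrak{g})\mid\phi(\mathfrak{h})=\mathfrak{h}\}$ for a subalgebra $\mathfrak{h}$. $\mathfrak{h}$ is $\Sigma$-invariant if $\mathrm{Aut}_\Sigma(\mathfrak{g},\mathfrak{h})$ maps onto $\Sigma$. $\mathfrak{g}$ is $\Sigma$-simple if it is not abelian and has no non-trivial proper $\Sigma$-invariant ideal; then it is a direct sum of $n$ copies of a simple Lie algebra $\mathfrak{g}_s$, permuted transitively by $\Sigma$. A $\Sigma$-primitive subalgebra of $\mathfrak{g}$ is a proper $\Sigma$-invariant subalgebra $\mathfrak{m}$ which contains no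 non-trivial proper $\Sigma$-invariant ideal of $\mathfrak{g}$ and such that any $\mathrm{Aut}_\Sigma(\mathfrak{g},\mathfrak{m})$-invariant subalgebra $\tilde{\mathfrak{m}}$ with $\mathfrak{m}\subset\tilde{\mathfrak{m}}\subset\mathfrak{g}$ equals $\mathfrak{m}$ or $\mathfrak{g}$. Here $\mathrm{Aut}(\mathfrak{g})=\mathrm{Aut}(\mathfrak{g}_s)^n:S_n$ and $\mathrm{Out}(\mathfrak{g})=\mathrm{Out}(\mathfrak{g}_s)^n:S_n$ (wreath products), with $(\varphi_1,\ldots,\varphi_n;\pi)\cdot(X_1,\ldots,X_n)=(\varphi_1(X_{\pi(1)}),\ldots,\varphi_n(X_{\pi(n)}))$. $\Sigma$ acts on $\{1,\ldots,n\}$ through the projection $\mathrm{Out}(\mathfrak{g})\to S_n$. ``Twisting'' with an automorphism $\phi$ of $\mathfrak{g}$ means modifying the identification $\mathfrak{g}=\mathfrak{g}_s\oplus\ldots\oplus\mathfrak{g}_s$ by $\phi$, i.e. replacing $\mathfrak{m}$ by $\phi(\mathfrak{m})$ and $\Sigma$ by its conjugate under the class of $\phi$ in $\mathrm{Out}(\mathfrak{g})$. For each $i$, $\Sigma_{s,i}\subset\mathrm{Out}(\mathfrak{g}_s)$ is the set of all $\sigma_i$ for which there is $(\sigma_1,\ldots,\sigma_n;\pi)\in\Sigma$ with $\pi(i)=i$; after a suitable twist by an automorphism, all $\Sigma_{s,i}$ coincide, and their common value is the group $\Sigma_s$ ``obtained from $\Sigma$ by projection''. *)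

theory Defs
  imports "HOL-Analysis.Analysis" "HOL-Algebra.Coset" "HOL-Algebra.Generated_Groups"
begin

section \<open>Finite-dimensional Lie algebras\<close>

record ('k, 'a) lie_struct =
  scal :: "'k \<Rightarrow> 'a \<Rightarrow> 'a"
  brac :: "'a \<Rightarrow> 'a \<Rightarrow> 'a"

text \<open>The underlying space is a whole type of class \<open>euclidean_space\<close>. This expresses that the Lie
  algebra is finite-dimensional over the reals and provides the topology needed for the exponential
  series; the inner product is otherwise irrelevant. A field \<open>'k\<close> acting on such a space compatibly
  with the real scalars is a finite extension of the reals, so the base field is the field of real
  numbers (with \<open>scal L = scaleR\<close>) or that of complex numbers.\<close>

locale lie_algebra = vector_space "scal L"
  for L :: "('k::real_normed_field, 'a::euclidean_space) lie_struct" +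
  assumes scal_of_real: "scal L (of_real r) x = r *\<^sub>R x"
    and brac_linear_left: "Vector_Spaces.linear (scal L) (scal L) (\<lambda>x. brac L x y)"
    and brac_linear_right: "Vector_Spaces.linear (scal L) (scal L) (\<lambda>y. brac L x y)"
    and brac_self: "brac L x x = 0"
    and jacobi: "brac L x (brac L y z) + brac L y (brac L z x) + brac L z (brac L x y) = 0"

definition lie_subalgebra ::
  "('k::real_normed_field, 'a::euclidean_space) lie_struct \<Rightarrow> 'a set \<Rightarrow> bool" where
  "lie_subalgebra L h \<longleftrightarrow> module.subspace (scal L) h \<and> (\<forall>x\<in>h. \<forall>y\<in>h. brac L x y \<in> h)"

definition lie_ideal ::
  "('k::real_normed_field, 'a::euclidean_space) lie_struct \<Rightarrow> 'a set \<Rightarrow> bool" where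
  "lie_ideal L I \<longleftrightarrow> module.subspace (scal L) I \<and> (\<forall>x. \<forall>y\<in>I. brac L x y \<in> I)"

definition lie_abelian ::
  "('k::real_normed_field, 'a::euclidean_space) lie_struct \<Rightarrow> bool" where
  "lie_abelian L \<longleftrightarrow> (\<forall>x y. brac L x y = 0)"

definition lie_simple ::
  "('k::real_normed_field, 'a::euclidean_space) lie_struct \<Rightarrow> bool" where
  "lie_simple L \<longleftrightarrow> \<not> lie_abelian L \<and> (\<forall>I. lie_ideal L I \<longrightarrow> I = {0} \<or> I = UNIV)"

definition lie_hom ::
  "('k::real_normed_field, 'a::euclidean_space) lie_struct \<Rightarrow>
   ('k, 'b::euclidean_space) lie_struct \<Rightarrow> ('a \<Rightarrow> 'b) \<Rightarrow> bool" where
  "lie_hom L M f \<longleftrightarrow> Vector_Spaces.linear (scal L) (scal M) f \<and>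
     (\<forall>x y. f (brac L x y) = brac M (f x) (f y))"


section \<open>Inner and outer automorphisms\<close>

definition Aut ::
  "('k::real_normed_field, 'a::euclidean_space) lie_struct \<Rightarrow> ('a \<Rightarrow> 'a) monoid" where
  "Aut L = \<lparr>carrier = {\<phi>. lie_hom L L \<phi> \<and> bij \<phi>}, mult = (\<circ>), one = id\<rparr>"

definition exp_ad ::
  "('k::real_normed_field, 'a::euclidean_space) lie_struct \<Rightarrow> 'a \<Rightarrow> 'a \<Rightarrow> 'a" where
  "exp_ad L x = (\<lambda>y. \<Sum>k. (brac L x ^^ k) y /\<^sub>R fact k)"

text \<open>A connected Lie group \<open>G\<^sub>0\<close> is generated by the image of its exponential map, and
  \<open>Ad (exp x) = exp (ad x)\<close>; hence \<open>Ad G\<^sub>0\<close> is the group generated by all \<open>exp (ad x)\<close>.\<close>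

definition Inn ::
  "('k::real_normed_field, 'a::euclidean_space) lie_struct \<Rightarrow> ('a \<Rightarrow> 'a) set" where
  "Inn L = generate (Aut L) (range (exp_ad L))"

definition Out ::
  "('k::real_normed_field, 'a::euclidean_space) lie_struct \<Rightarrow> ('a \<Rightarrow> 'a) set monoid" where
  "Out L = Aut L Mod Inn L"

definition out_class ::
  "('k::real_normed_field, 'a::euclidean_space) lie_struct \<Rightarrow> ('a \<Rightarrow> 'a) \<Rightarrow> ('a \<Rightarrow> 'a) set" where
  "out_class L \<phi> = Inn L #>\<^bsub>Aut L\<^esub> \<phi>"

definition Aut_over ::
  "('k::real_normed_field, 'a::euclidean_space) lie_struct \<Rightarrow> ('a \<Rightarrow> 'a) set set \<Rightarrow>
   ('a \<Rightarrow> 'a) set" where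
  "Aut_over L \<Sigma> = {\<phi> \<in> carrier (Aut L). out_class L \<phi> \<in> \<Sigma>}"

definition Aut_over_stab ::
  "('k::real_normed_field, 'a::euclidean_space) lie_struct \<Rightarrow> ('a \<Rightarrow> 'a) set set \<Rightarrow>
   'a set \<Rightarrow> ('a \<Rightarrow> 'a) set" where
  "Aut_over_stab L \<Sigma> h = {\<phi> \<in> Aut_over L \<Sigma>. \<phi> ` h = h}"

definition Sigma_invariant ::
  "('k::real_normed_field, 'a::euclidean_space) lie_struct \<Rightarrow> ('a \<Rightarrow> 'a) set set \<Rightarrow>
   'a set \<Rightarrow> bool" where
  "Sigma_invariant L \<Sigma> h \<longleftrightarrow> out_class L ` Aut_over_stab L \<Sigma> h = \<Sigma>"

definition Sigma_simple ::
  "('k::real_normed_field, 'a::euclidean_space) lie_struct \<Rightarrow> ('a \<Rightarrow> 'a) set set \<Rightarrow> bool" where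
  "Sigma_simple L \<Sigma> \<longleftrightarrow> \<not> lie_abelian L \<and>
     (\<forall>I. lie_ideal L I \<and> Sigma_invariant L \<Sigma> I \<longrightarrow> I = {0} \<or> I = UNIV)"

definition Sigma_primitive ::
  "('k::real_normed_field, 'a::euclidean_space) lie_struct \<Rightarrow> ('a \<Rightarrow> 'a) set set \<Rightarrow>
   'a set \<Rightarrow> bool" where
  "Sigma_primitive L \<Sigma> m \<longleftrightarrow>
     lie_subalgebra L m \<and> m \<noteq> UNIV \<and> Sigma_invariant L \<Sigma> m \<and>
     (\<forall>I. lie_ideal L I \<and> Sigma_invariant L \<Sigma> I \<and> I \<subseteq> m \<longrightarrow> I = {0} \<or> I = UNIV) \<and>
     (\<forall>m'. lie_subalgebra L m' \<and> (\<forall>\<phi>\<in>Aut_over_stab L \<Sigma> m. \<phi> ` m' = m') \<and> m \<subseteq> m' \<longrightarrow>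
        m' = m \<or> m' = UNIV)"


section \<open>Direct sums of copies of one Lie algebra\<close>

text \<open>\<open>\<kappa>\<close> identifies \<open>L\<close> with the direct sum of \<open>n\<close> copies of \<open>S\<close>: the components of \<open>X\<close> are
  \<open>\<kappa> X 1, \<dots>, \<kappa> X n\<close>. Values of \<open>\<kappa> X\<close> outside \<open>{1..n}\<close> are irrelevant.\<close>

definition direct_power ::
  "('k::real_normed_field, 'a::euclidean_space) lie_struct \<Rightarrow>
   ('k, 'b::euclidean_space) lie_struct \<Rightarrow> nat \<Rightarrow> ('a \<Rightarrow> nat \<Rightarrow> 'b) \<Rightarrow> bool" where
  "direct_power L S n \<kappa> \<longleftrightarrow>
     (\<forall>i\<in>{1..n}. lie_hom L S (\<lambda>X. \<kappa> X i)) \<and>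
     bij_betw (\<lambda>X. restrict (\<kappa> X) {1..n}) UNIV ({1..n} \<rightarrow>\<^sub>E UNIV)"

definition aut_components ::
  "('k::real_normed_field, 'b::euclidean_space) lie_struct \<Rightarrow> nat \<Rightarrow>
   ('a::euclidean_space \<Rightarrow> nat \<Rightarrow> 'b) \<Rightarrow>
   ('a \<Rightarrow> 'a) \<Rightarrow> (nat \<Rightarrow> 'b \<Rightarrow> 'b) \<Rightarrow> (nat \<Rightarrow> nat) \<Rightarrow> bool" where
  "aut_components S n \<kappa> \<phi> \<phi>s \<pi> \<longleftrightarrow>
     \<pi> permutes {1..n} \<and> (\<forall>i\<in>{1..n}. \<phi>s i \<in> carrier (Aut S)) \<and>
     (\<forall>X. \<forall>i\<in>{1..n}. \<kappa> (\<phi> X) i = \<phi>s i (\<kappa> X (\<pi> i)))"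

text \<open>\<open>\<sigma> = (\<sigma>s 1, \<dots>, \<sigma>s n; \<pi>)\<close> under the identification of \<open>Out L\<close> with a wreath product
  that is induced by the one for \<open>Aut L\<close>.\<close>

definition out_components ::
  "('k::real_normed_field, 'a::euclidean_space) lie_struct \<Rightarrow>
   ('k, 'b::euclidean_space) lie_struct \<Rightarrow> nat \<Rightarrow> ('a \<Rightarrow> nat \<Rightarrow> 'b) \<Rightarrow>
   ('a \<Rightarrow> 'a) set \<Rightarrow> (nat \<Rightarrow> ('b \<Rightarrow> 'b) set) \<Rightarrow> (nat \<Rightarrow> nat) \<Rightarrow> bool" where
  "out_components L S n \<kappa> \<sigma> \<sigma>s \<pi> \<longleftrightarrow>
     (\<exists>\<phi>\<in>carrier (Aut L). \<exists>\<phi>s. aut_components S n \<kappa> \<phi> \<phi>s \<pi> \<and>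
        \<sigma> = out_class L \<phi> \<and> (\<forall>i\<in>{1..n}. \<sigma>s i = out_class S (\<phi>s i)))"

definition Sigma_proj ::
  "('k::real_normed_field, 'a::euclidean_space) lie_struct \<Rightarrow>
   ('k, 'b::euclidean_space) lie_struct \<Rightarrow> nat \<Rightarrow> ('a \<Rightarrow> nat \<Rightarrow> 'b) \<Rightarrow>
   ('a \<Rightarrow> 'a) set set \<Rightarrow> nat \<Rightarrow> ('b \<Rightarrow> 'b) set set" where
  "Sigma_proj L S n \<kappa> \<Sigma> i =
     {\<sigma>s i | \<sigma> \<sigma>s \<pi>. \<sigma> \<in> \<Sigma> \<and> out_components L S n \<kappa> \<sigma> \<sigma>s \<pi> \<and> \<pi> i = i}"

definition Sigma_invariant_partition ::
  "('k::real_normed_field, 'a::euclidean_space) lie_struct \<Rightarrow>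
   ('k, 'b::euclidean_space) lie_struct \<Rightarrow> nat \<Rightarrow> ('a \<Rightarrow> nat \<Rightarrow> 'b) \<Rightarrow>
   ('a \<Rightarrow> 'a) set set \<Rightarrow> nat set set \<Rightarrow> bool" where
  "Sigma_invariant_partition L S n \<kappa> \<Sigma> P \<longleftrightarrow>
     (\<forall>\<sigma>\<in>\<Sigma>. \<forall>\<sigma>s \<pi>. out_components L S n \<kappa> \<sigma> \<sigma>s \<pi> \<longrightarrow> (\<forall>B\<in>P. \<pi> ` B \<in> P))"

definition twist_Sigma ::
  "('k::real_normed_field, 'a::euclidean_space) lie_struct \<Rightarrow> ('a \<Rightarrow> 'a) \<Rightarrow>
   ('a \<Rightarrow> 'a) set set \<Rightarrow> ('a \<Rightarrow> 'a) set set" where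
  "twist_Sigma L \<phi> \<Sigma> =
     {out_class L \<phi> \<otimes>\<^bsub>Out L\<^esub> \<sigma> \<otimes>\<^bsub>Out L\<^esub> inv\<^bsub>Out L\<^esub> out_class L \<phi> | \<sigma>. \<sigma> \<in> \<Sigma>}"

definition block :: "nat \<Rightarrow> nat \<Rightarrow> nat set" where
  "block p j = {j * p + 1..(j + 1) * p}"

definition copies_sum :: "nat \<Rightarrow> ('a \<Rightarrow> nat \<Rightarrow> 'b) \<Rightarrow> 'b set \<Rightarrow> 'a set" where
  "copies_sum n \<kappa> ms = {X. \<forall>i\<in>{1..n}. \<kappa> X i \<in> ms}"

text \<open>\<open>q\<close> consecutive copies of the diagonal in \<open>p\<close> summands; \<open>Y j\<close> is the common value of the
  entries in the \<open>j\<close>-th copy.\<close>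

definition diag_sum :: "nat \<Rightarrow> nat \<Rightarrow> ('a \<Rightarrow> nat \<Rightarrow> 'b) \<Rightarrow> 'a set" where
  "diag_sum p q \<kappa> = {X. \<exists>Y. \<forall>j<q. \<forall>i\<in>block p j. \<kappa> X i = Y j}"

definition simple_type ::
  "('k::real_normed_field, 'a::euclidean_space) lie_struct \<Rightarrow>
   ('k, 'b::euclidean_space) lie_struct \<Rightarrow> nat \<Rightarrow> ('a \<Rightarrow> nat \<Rightarrow> 'b) \<Rightarrow>
   ('a \<Rightarrow> 'a) set set \<Rightarrow> 'a set \<Rightarrow> bool" where
  "simple_type L S n \<kappa> \<Sigma> m \<longleftrightarrow>
     (\<exists>\<phi>\<in>carrier (Aut L). \<exists>\<Sigma>s ms.
        subgroup \<Sigma>s (Out S) \<and>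
        (\<forall>i\<in>{1..n}. Sigma_proj L S n \<kappa> (twist_Sigma L \<phi> \<Sigma>) i = \<Sigma>s) \<and>
        Sigma_primitive S \<Sigma>s ms \<and>
        \<phi> ` m = copies_sum n \<kappa> ms)"

text \<open>Minimality of \<open>p\<close> and maximality of \<open>q\<close> refer to the numbering of the summands and the
  group \<open>\<Sigma>\<close> obtained after twisting.\<close>

definition diagonal_type ::
  "('k::real_normed_field, 'a::euclidean_space) lie_struct \<Rightarrow>
   ('k, 'b::euclidean_space) lie_struct \<Rightarrow> nat \<Rightarrow> ('a \<Rightarrow> nat \<Rightarrow> 'b) \<Rightarrow>
   ('a \<Rightarrow> 'a) set set \<Rightarrow> 'a set \<Rightarrow> bool" where
  "diagonal_type L S n \<kappa> \<Sigma> m \<longleftrightarrow>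
     (\<exists>\<phi>\<in>carrier (Aut L). \<exists>p q.
        p * q = n \<and> p > 1 \<and> q < n \<and>
        \<phi> ` m = diag_sum p q \<kappa> \<and>
        Sigma_invariant_partition L S n \<kappa> (twist_Sigma L \<phi> \<Sigma>) (block p ` {..<q}) \<and>
        (\<forall>p' q'. p' * q' = n \<and> p' > 1 \<and> q' < n \<and>
           Sigma_invariant_partition L S n \<kappa> (twist_Sigma L \<phi> \<Sigma>) (block p' ` {..<q'}) \<longrightarrow>
           p \<le> p' \<and> q' \<le> q))"

end

theory Submission imports Defs begin

text \<open>
  Let \<open>G\<close> be the stabilizer of \<open>m\<close> in the group of automorphisms whose class lies in \<open>\<Sigma>\<close>.
  The sum of all projections of \<open>m\<close> to the summands \<open>\<kappa> X i\<close> is a \<open>G\<close>-invariant subalgebra that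
  contains \<open>m\<close>, so by primitivity it is \<open>m\<close> or everything, and these are the two alternatives.

  Automorphisms of \<open>L\<close> permute the summands (\<open>Aut_components_exist\<close>), inner ones act summandwise by
  inner automorphisms (\<open>Inn_components\<close>), and \<open>\<Sigma>\<close>-simplicity makes the action on the indices
  transitive, because the summands of an orbit span an invariant ideal. By \<open>\<Sigma>\<close>-invariance of
  \<open>m\<close>, \<open>G\<close> maps onto \<open>\<Sigma>\<close>, so \<open>G\<close> itself is transitive on the indices.

  If \<open>m\<close> is the sum of its projections, then elements of \<open>G\<close> carrying the \<open>i\<close>-th summand to the
  first identify the projections; twisting by them makes \<open>m\<close> a sum of copies of one \<open>ms\<close>
  (\<open>product_normal_form\<close>). A subalgebra of \<open>S\<close> between \<open>ms\<close> and \<open>S\<close> invariant under the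
  automorphisms that \<open>G\<close> induces on one summand gives, by taking copies, a \<open>G\<close>-invariant subalgebra
  above \<open>m\<close>; hence \<open>ms\<close> is primitive (\<open>induced_maximal_invariant\<close>).

  If all projections are onto, Goursat's lemma for the simple algebra \<open>S\<close> (\<open>coupled_iso\<close>,
  \<open>subdirect_memI\<close>) shows that \<open>m\<close> is a sum of twisted diagonals over the classes of an
  equivalence relation on the indices. The relation is \<open>G\<close>-invariant, so by transitivity its classes
  have equal size, and a twist brings \<open>m\<close> into the standard form (\<open>diagonal_normal_form\<close>). If another
  invariant partition into consecutive blocks had smaller blocks of more than one element, the common
  refinement of both partitions would define an invariant subalgebra strictly between \<open>m\<close> and \<open>L\<close>
  (\<open>diag_sum_block_minimal\<close>).

  On the analytic side, \<open>exp_ad L x\<close> must be shown to be an automorphism. This comes down to Cauchy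
  products: the Leibniz rule makes it multiplicative, and the binomial theorem makes
  \<open>exp_ad L (- x)\<close> its inverse. Hence \<open>Inn L\<close> is a normal subgroup and \<open>Out L\<close> a group.
\<close>

section \<open>Homomorphisms, subalgebras and ideals\<close>

lemma lie_hom_iff:
  assumes "lie_algebra L" "lie_algebra M"
  shows "lie_hom L M f \<longleftrightarrow> (\<forall>x y. f (x + y) = f x + f y) \<and>
    (\<forall>c x. f (scal L c x) = scal M c (f x)) \<and> (\<forall>x y. f (brac L x y) = brac M (f x) (f y))"
proof -
  interpret L: lie_algebra L by fact
  interpret M: lie_algebra M by fact
  have "vector_space_pair (scal L) (scal M)"
    by (simp add: vector_space_pair_def L.vector_space_axioms M.vector_space_axioms)
  then show ?thesis
    unfolding lie_hom_def by (auto simp: Vector_Spaces.linear_iff vector_space_pair_def)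
qed

context lie_algebra
begin

lemma lie_subalgebra_iff:
  "lie_subalgebra L h \<longleftrightarrow> 0 \<in> h \<and> (\<forall>x\<in>h. \<forall>y\<in>h. x + y \<in> h) \<and>
    (\<forall>c. \<forall>x\<in>h. scal L c x \<in> h) \<and> (\<forall>x\<in>h. \<forall>y\<in>h. brac L x y \<in> h)"
  unfolding lie_subalgebra_def subspace_def by blast

lemma lie_ideal_iff:
  "lie_ideal L I \<longleftrightarrow> 0 \<in> I \<and> (\<forall>x\<in>I. \<forall>y\<in>I. x + y \<in> I) \<and>
    (\<forall>c. \<forall>x\<in>I. scal L c x \<in> I) \<and> (\<forall>x. \<forall>y\<in>I. brac L x y \<in> I)"
  unfolding lie_ideal_def subspace_def by blast

lemma scaleR_conv_scal: "r *\<^sub>R x = scal L (of_real r) x"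
  by (simp add: scal_of_real)

lemma linear_scal: "linear (scal L c)"
  by (intro linearI) (simp_all add: scale_right_distrib scaleR_conv_scal mult.commute)

lemma brac_add_left: "brac L (x + y) z = brac L x z + brac L y z"
  and brac_scal_left: "brac L (scal L c x) z = scal L c (brac L x z)"
  and brac_add_right: "brac L z (x + y) = brac L z x + brac L z y"
  and brac_scal_right: "brac L z (scal L c x) = scal L c (brac L z x)"
  using brac_linear_left[of z] brac_linear_right[of z]
  by (simp_all add: Vector_Spaces.linear_iff)

lemma linear_brac_left: "linear (\<lambda>x. brac L x z)"
  and linear_brac_right: "linear (brac L z)"
  by (intro linearI;
      simp add: brac_add_left brac_add_right brac_scal_left brac_scal_right scaleR_conv_scal)+

lemma bilinear_brac: "bilinear (brac L)"
  unfolding bilinear_def by (auto intro: linear_brac_left linear_brac_right)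

lemma brac_zero_left [simp]: "brac L 0 x = 0" and brac_zero_right [simp]: "brac L x 0 = 0"
  using linear_0[OF linear_brac_left] linear_0[OF linear_brac_right] by auto

lemma brac_minus_left: "brac L (- x) y = - brac L x y"
  using linear_neg[OF linear_brac_left] by auto

lemma brac_anticomm: "brac L y x = - brac L x y"
proof -
  have "0 = brac L (x + y) (x + y)" by (simp add: brac_self)
  also have "\<dots> = brac L x y + brac L y x"
    unfolding brac_add_left brac_add_right by (simp add: brac_self)
  finally show ?thesis by (simp add: eq_neg_iff_add_eq_0 add.commute)
qed

lemma brac_derivation: "brac L x (brac L y z) = brac L (brac L x y) z + brac L y (brac L x z)"
proof -
  have "brac L y (brac L z x) = - brac L y (brac L x z)"
    by (subst brac_anticomm[of z x]) (simp add: linear_neg[OF linear_brac_right])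
  moreover have "brac L z (brac L x y) = - brac L (brac L x y) z" by (rule brac_anticomm)
  ultimately show ?thesis using jacobi[of x y z]
    by (simp add: algebra_simps add_eq_0_iff)
qed

end

lemma linear_lie_hom:
  assumes "lie_algebra L" "lie_algebra M" "lie_hom L M f"
  shows "linear f"
  using assms by (auto simp: lie_hom_iff intro!: linearI simp: lie_algebra.scaleR_conv_scal)

lemma lie_hom_comp:
  assumes "lie_algebra L" "lie_algebra M" "lie_algebra N" "lie_hom L M f" "lie_hom M N g"
  shows "lie_hom L N (g \<circ> f)"
  using assms by (simp add: lie_hom_iff)

lemma lie_hom_id: "lie_algebra L \<Longrightarrow> lie_hom L L id"
  by (simp add: lie_hom_iff)

lemma lie_hom_inv:
  assumes "lie_algebra L" "lie_hom L L f" "bij f"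
  shows "lie_hom L L (Hilbert_Choice.inv f)"
proof -
  have "Hilbert_Choice.inv f (f x) = x" "f (Hilbert_Choice.inv f x) = x" for x
    using assms(3) by (simp_all add: bij_is_inj bij_is_surj surj_f_inv_f)
  with assms show ?thesis by (simp add: lie_hom_iff) (metis)
qed

text \<open>\<open>J\<close> is only required to be stable under brackets with the subalgebra \<open>h\<close>, not with \<open>L\<close>.\<close>

lemma lie_hom_image_ideal:
  assumes "lie_algebra L" "lie_algebra M" "lie_hom L M f" "lie_subalgebra L h" "f ` h = UNIV"
    and "0 \<in> J" "\<And>x y. x \<in> J \<Longrightarrow> y \<in> J \<Longrightarrow> x + y \<in> J" "\<And>c x. x \<in> J \<Longrightarrow> scal L c x \<in> J"
      "\<And>x y. x \<in> h \<Longrightarrow> y \<in> J \<Longrightarrow> brac L x y \<in> J"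
  shows "lie_ideal M (f ` J)"
  unfolding lie_algebra.lie_ideal_iff[OF assms(2)]
proof (intro conjI allI ballI)
  note f = assms(3)[unfolded lie_hom_iff[OF assms(1,2)]]
  have "f 0 = 0" by (rule linear_0[OF linear_lie_hom[OF assms(1-3)]])
  with assms(6) show "0 \<in> f ` J" by (metis imageI)
  fix u v c assume "u \<in> f ` J"
  then obtain x where x: "x \<in> J" "u = f x" by blast
  show "scal M c u \<in> f ` J"
    using imageI[OF assms(8)[OF x(1), of c], of f] f x(2) by simp
  obtain y where y: "y \<in> h" "v = f y" using assms(5) by (metis UNIV_I imageE)
  show "brac M v u \<in> f ` J"
    using imageI[OF assms(9)[OF y(1) x(1)], of f] f x(2) y(2) by simp
next
  note f = assms(3)[unfolded lie_hom_iff[OF assms(1,2)]]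
  fix u v assume "u \<in> f ` J" "v \<in> f ` J"
  then obtain x y where xy: "x \<in> J" "u = f x" "y \<in> J" "v = f y" by blast
  show "u + v \<in> f ` J"
    using imageI[OF assms(7)[OF xy(1,3)], of f] f xy(2,4) by simp
qed

lemma lie_hom_kernel_ideal:
  assumes "lie_algebra L" "lie_algebra M" "lie_hom L M f"
  shows "lie_ideal L {x. f x = 0}"
proof -
  interpret L: lie_algebra L by fact
  interpret M: lie_algebra M by fact
  show ?thesis
  using assms linear_0[OF linear_lie_hom[OF assms]]
  by (auto simp: lie_hom_iff L.lie_ideal_iff)
qed

lemma lie_simple_nontrivial:
  assumes "lie_algebra S" "lie_simple S"
  obtains x y where "brac S x y \<noteq> 0" "x \<noteq> 0"
proof -
  interpret S: lie_algebra S by fact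
  obtain x y where "brac S x y \<noteq> 0"
    using assms(2) by (auto simp: lie_simple_def lie_abelian_def)
  then show ?thesis using that by (metis S.brac_zero_left)
qed

text \<open>An endomorphism of a simple algebra that is onto is injective, its kernel being a proper ideal.\<close>

lemma lie_simple_surj_bij:
  assumes "lie_algebra S" "lie_simple S" "lie_hom S S f" "surj f"
  shows "bij f"
proof -
  obtain a :: 'b where "a \<noteq> 0" using lie_simple_nontrivial[OF assms(1,2)] by blast
  then obtain b where "f b \<noteq> 0" using assms(4) by (metis surjD)
  moreover have "{x. f x = 0} = {0} \<or> {x. f x = 0} = UNIV"
    using lie_hom_kernel_ideal[OF assms(1,1,3)] assms(2) unfolding lie_simple_def by blast
  ultimately have "{x. f x = 0} = {0}" by auto
  then have "inj f"
    by (subst linear_injective_0[OF linear_lie_hom[OF assms(1,1,3)]]) auto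
  with assms(4) show ?thesis by (simp add: bij_def)
qed

section \<open>The automorphism group\<close>

lemma carrier_Aut: "\<phi> \<in> carrier (Aut L) \<longleftrightarrow> lie_hom L L \<phi> \<and> bij \<phi>"
  and mult_Aut: "\<phi> \<otimes>\<^bsub>Aut L\<^esub> \<psi> = \<phi> \<circ> \<psi>"
  and one_Aut: "\<one>\<^bsub>Aut L\<^esub> = id"
  by (simp_all add: Aut_def)

lemma group_Aut:
  assumes "lie_algebra L"
  shows "group (Aut L)"
proof (rule groupI)
  fix x assume "x \<in> carrier (Aut L)"
  then have "Hilbert_Choice.inv x \<in> carrier (Aut L)" "Hilbert_Choice.inv x \<otimes>\<^bsub>Aut L\<^esub> x = \<one>\<^bsub>Aut L\<^esub>"
    using assms by (simp_all add: carrier_Aut mult_Aut one_Aut lie_hom_inv bij_imp_bij_inv bij_is_inj)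
  then show "\<exists>y\<in>carrier (Aut L). y \<otimes>\<^bsub>Aut L\<^esub> x = \<one>\<^bsub>Aut L\<^esub>" by blast
qed (use assms in \<open>auto simp: carrier_Aut mult_Aut one_Aut lie_hom_id bij_comp
        intro!: lie_hom_comp[of L L]\<close>)

lemma inv_Aut:
  assumes "lie_algebra L" "\<phi> \<in> carrier (Aut L)"
  shows "inv\<^bsub>Aut L\<^esub> \<phi> = Hilbert_Choice.inv \<phi>"
proof (rule group.inv_equality[OF group_Aut[OF assms(1)]])
  show "Hilbert_Choice.inv \<phi> \<otimes>\<^bsub>Aut L\<^esub> \<phi> = \<one>\<^bsub>Aut L\<^esub>" "Hilbert_Choice.inv \<phi> \<in> carrier (Aut L)"
    using assms by (simp_all add: carrier_Aut mult_Aut one_Aut lie_hom_inv bij_imp_bij_inv bij_is_inj)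
qed fact

section \<open>Inner automorphisms\<close>

text \<open>Expanding in orthonormal bases reduces the bilinear case to real series.\<close>

lemma Cauchy_product_bilinear:
  fixes h :: "'x::euclidean_space \<Rightarrow> 'y::euclidean_space \<Rightarrow> 'z::euclidean_space"
  assumes "bilinear h" and a: "summable (\<lambda>k. norm (a k))" and b: "summable (\<lambda>k. norm (b k))"
  shows "(\<lambda>n. \<Sum>k\<le>n. h (a k) (b (n - k))) sums h (\<Sum>k. a k) (\<Sum>k. b k)"
proof -
  have expand: "h x y = (\<Sum>i\<in>Basis. \<Sum>j\<in>Basis. ((x \<bullet> i) * (y \<bullet> j)) *\<^sub>R h i j)" for x y
  proof -
    have "h x y = h (\<Sum>i\<in>Basis. (x \<bullet> i) *\<^sub>R i) (\<Sum>j\<in>Basis. (y \<bullet> j) *\<^sub>R j)"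
      by (simp add: euclidean_representation)
    also have "\<dots> = (\<Sum>(i,j)\<in>Basis \<times> Basis. h ((x \<bullet> i) *\<^sub>R i) ((y \<bullet> j) *\<^sub>R j))"
      by (rule bilinear_sum[OF assms(1)])
    finally show ?thesis
      by (simp add: sum.cartesian_product bilinear_lmul[OF assms(1)] bilinear_rmul[OF assms(1)]
          split_def mult.commute)
  qed
  have comp: "summable (\<lambda>k. norm (c k \<bullet> i)) \<and> (\<Sum>k. c k \<bullet> i) = (\<Sum>k. c k) \<bullet> i"
    if "summable (\<lambda>k. norm (c k))" "i \<in> Basis" for c :: "nat \<Rightarrow> 'w::euclidean_space" and i
    using that Basis_le_norm
    by (auto intro!: summable_comparison_test'[OF that(1), of 0] bounded_linear.suminf[OF bounded_linear_inner_left, symmetric]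
          dest: summable_norm_cancel)
  have "(\<lambda>n. \<Sum>k\<le>n. (a k \<bullet> i) * (b (n - k) \<bullet> j)) sums (((\<Sum>k. a k) \<bullet> i) * ((\<Sum>k. b k) \<bullet> j))"
    if "i \<in> Basis" "j \<in> Basis" for i j
    using Cauchy_product_sums[of "\<lambda>k. a k \<bullet> i" "\<lambda>k. b k \<bullet> j"] comp[OF a] comp[OF b] that by simp
  then have "(\<lambda>n. \<Sum>i\<in>Basis. \<Sum>j\<in>Basis. (\<Sum>k\<le>n. (a k \<bullet> i) * (b (n - k) \<bullet> j)) *\<^sub>R h i j)
     sums (\<Sum>i\<in>Basis. \<Sum>j\<in>Basis. (((\<Sum>k. a k) \<bullet> i) * ((\<Sum>k. b k) \<bullet> j)) *\<^sub>R h i j)"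
    by (intro sums_sum sums_scaleR_left)
  moreover have "(\<Sum>i\<in>Basis. \<Sum>j\<in>Basis. (\<Sum>k\<le>n. (a k \<bullet> i) * (b (n - k) \<bullet> j)) *\<^sub>R h i j)
      = (\<Sum>k\<le>n. h (a k) (b (n - k)))" for n
    unfolding expand[of "a _"] scaleR_sum_left
    by (simp only: sum.swap[where A = "{..n}"])
  ultimately show ?thesis by (simp add: expand[of "\<Sum>k. a k"])
qed

context lie_algebra
begin

lemma linear_ad_power: "linear (brac L x ^^ k)"
proof (induction k)
  case (Suc k)
  then show ?case using linear_compose[OF Suc linear_brac_right[of x]] by (simp only: funpow.simps)
qed (simp add: real_vector.linear_ident)

lemma summable_norm_exp_ad: "summable (\<lambda>k. norm ((brac L x ^^ k) y /\<^sub>R fact k))"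
proof -
  obtain B where B: "norm (brac L x z) \<le> B * norm z" "B > 0" for z
    using linear_bounded_pos[OF linear_brac_right[of x]] by blast
  have "norm ((brac L x ^^ k) y) \<le> B ^ k * norm y" for k
  proof (induction k)
    case (Suc k)
    have "norm ((brac L x ^^ Suc k) y) \<le> B * norm ((brac L x ^^ k) y)" using B(1) by simp
    also have "\<dots> \<le> B * (B ^ k * norm y)" using Suc B(2) by simp
    finally show ?case by simp
  qed simp
  then have "norm (norm ((brac L x ^^ k) y /\<^sub>R fact k)) \<le> (B ^ k /\<^sub>R fact k) * norm y" for k
    by (simp add: mult_left_mono mult.assoc)
  moreover have "summable (\<lambda>k. (B ^ k /\<^sub>R fact k) * norm y)"
    by (intro summable_mult2 summable_exp_generic)
  ultimately show ?thesis
    by (auto intro: summable_comparison_test'[of "\<lambda>k. (B ^ k /\<^sub>R fact k) * norm y" 0])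
qed

lemma exp_ad_sums: "(\<lambda>k. (brac L x ^^ k) y /\<^sub>R fact k) sums exp_ad L x y"
  unfolding exp_ad_def using summable_norm_exp_ad[of x y]
  by (intro summable_sums) (rule summable_norm_cancel)

lemma suminf_exp_ad: "(\<Sum>k. (brac L x ^^ k) y /\<^sub>R fact k) = exp_ad L x y"
  by (simp add: exp_ad_def)

end

lemma lie_hom_exp_ad:
  assumes "lie_algebra L" "lie_algebra M" "lie_hom L M f"
  shows "f (exp_ad L x y) = exp_ad M (f x) (f y)"
proof -
  note lin = linear_lie_hom[OF assms]
  have pow: "f ((brac L x ^^ k) y) = (brac M (f x) ^^ k) (f y)" for k
    by (induction k) (use assms in \<open>auto simp: lie_hom_iff\<close>)
  have "(\<lambda>k. f ((brac L x ^^ k) y /\<^sub>R fact k)) sums f (exp_ad L x y)"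
    using lin by (rule bounded_linear.sums[OF linear_conv_bounded_linear[THEN iffD1] lie_algebra.exp_ad_sums[OF assms(1)]])
  moreover have "f ((brac L x ^^ k) y /\<^sub>R fact k) = (brac M (f x) ^^ k) (f y) /\<^sub>R fact k" for k
    by (simp add: linear_cmul[OF lin] pow)
  ultimately show ?thesis
    using lie_algebra.exp_ad_sums[OF assms(2), of "f x" "f y"] by (simp add: sums_unique2)
qed

context lie_algebra
begin

lemma exp_ad_add: "exp_ad L x (y + z) = exp_ad L x y + exp_ad L x z"
proof -
  have "(\<lambda>k. (brac L x ^^ k) y /\<^sub>R fact k + (brac L x ^^ k) z /\<^sub>R fact k) sums (exp_ad L x y + exp_ad L x z)"
    by (intro sums_add exp_ad_sums)
  then show ?thesis using exp_ad_sums[of x "y + z"]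
    by (simp add: linear_add[OF linear_ad_power] scaleR_add_right sums_unique2)
qed

lemma exp_ad_scal: "exp_ad L x (scal L c y) = scal L c (exp_ad L x y)"
proof -
  have pow: "(brac L x ^^ k) (scal L c y) = scal L c ((brac L x ^^ k) y)" for k
    by (induction k) (auto simp: brac_scal_right)
  have "(\<lambda>k. scal L c ((brac L x ^^ k) y /\<^sub>R fact k)) sums scal L c (exp_ad L x y)"
    by (rule bounded_linear.sums[OF linear_conv_bounded_linear[THEN iffD1, OF linear_scal] exp_ad_sums])
  then show ?thesis using exp_ad_sums[of x "scal L c y"]
    by (simp add: pow linear_cmul[OF linear_scal] sums_unique2)
qed

text \<open>Leibniz rule for the divided powers of the derivation \<open>brac L x\<close>.\<close>

lemma ad_power_brac:
  "(brac L x ^^ n) (brac L y z) /\<^sub>R fact n =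
    (\<Sum>k\<le>n. brac L ((brac L x ^^ k) y /\<^sub>R fact k) ((brac L x ^^ (n - k)) z /\<^sub>R fact (n - k)))"
proof -
  let ?D = "\<lambda>k. brac L x ^^ k"
  have "?D n (brac L y z) = (\<Sum>k\<le>n. real (n choose k) *\<^sub>R brac L (?D k y) (?D (n - k) z))"
  proof (induction n)
    case (Suc n)
    let ?f = "\<lambda>k. brac L (?D k y) (?D (Suc n - k) z)"
    have "?D (Suc n) (brac L y z) = (\<Sum>k\<le>n. real (n choose k) *\<^sub>R brac L x (brac L (?D k y) (?D (n - k) z)))"
      by (simp add: Suc linear_sum[OF linear_brac_right] linear_cmul[OF linear_brac_right])
    also have "\<dots> = (\<Sum>k\<le>n. real (n choose k) *\<^sub>R ?f (Suc k)) + (\<Sum>k\<le>n. real (n choose k) *\<^sub>R ?f k)"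
      by (subst brac_derivation) (simp add: scaleR_add_right sum.distrib Suc_diff_le)
    also have "(\<Sum>k\<le>n. real (n choose k) *\<^sub>R ?f k) = (\<Sum>k\<le>Suc n. real (n choose k) *\<^sub>R ?f k)"
      by simp
    also have "\<dots> = ?f 0 + (\<Sum>k\<le>n. real (n choose Suc k) *\<^sub>R ?f (Suc k))"
      by (subst sum.atMost_Suc_shift) simp
    also have "(\<Sum>k\<le>n. real (n choose k) *\<^sub>R ?f (Suc k)) + \<dots> =
        ?f 0 + (\<Sum>k\<le>n. real (Suc n choose Suc k) *\<^sub>R ?f (Suc k))"
      by (simp add: sum.distrib scaleR_add_left)
    also have "\<dots> = (\<Sum>k\<le>Suc n. real (Suc n choose k) *\<^sub>R ?f k)"
      by (subst sum.atMost_Suc_shift) simp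
    finally show ?case .
  qed simp
  then have "?D n (brac L y z) /\<^sub>R fact n =
     (\<Sum>k\<le>n. (real (n choose k) / fact n) *\<^sub>R brac L (?D k y) (?D (n - k) z))"
    by (simp add: scaleR_sum_right divide_inverse mult.commute)
  also have "\<dots> = (\<Sum>k\<le>n. brac L (?D k y /\<^sub>R fact k) (?D (n - k) z /\<^sub>R fact (n - k)))"
  proof (intro sum.cong refl)
    fix k assume "k \<in> {..n}"
    then have "real (n choose k) / fact n = inverse (fact k) * inverse (fact (n - k))"
      by (simp add: binomial_fact field_simps)
    then show "(real (n choose k) / fact n) *\<^sub>R brac L (?D k y) (?D (n - k) z) =
        brac L (?D k y /\<^sub>R fact k) (?D (n - k) z /\<^sub>R fact (n - k))"
      by (simp add: linear_cmul[OF linear_brac_right] linear_cmul[OF linear_brac_left])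
  qed
  finally show ?thesis .
qed

lemma exp_ad_brac: "exp_ad L x (brac L y z) = brac L (exp_ad L x y) (exp_ad L x z)"
proof -
  have "(\<lambda>n. \<Sum>k\<le>n. brac L ((brac L x ^^ k) y /\<^sub>R fact k) ((brac L x ^^ (n - k)) z /\<^sub>R fact (n - k)))
      sums brac L (exp_ad L x y) (exp_ad L x z)"
    using Cauchy_product_bilinear[OF bilinear_brac summable_norm_exp_ad[of x y] summable_norm_exp_ad[of x z]]
    unfolding suminf_exp_ad .
  moreover have "(\<lambda>n. \<Sum>k\<le>n. brac L ((brac L x ^^ k) y /\<^sub>R fact k) ((brac L x ^^ (n - k)) z /\<^sub>R fact (n - k))) =
      (\<lambda>n. (brac L x ^^ n) (brac L y z) /\<^sub>R fact n)"
    by (rule ext, rule ad_power_brac[symmetric])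
  ultimately have "(\<lambda>n. (brac L x ^^ n) (brac L y z) /\<^sub>R fact n) sums brac L (exp_ad L x y) (exp_ad L x z)"
    by (rule back_subst[of "\<lambda>f. f sums brac L (exp_ad L x y) (exp_ad L x z)"])
  with exp_ad_sums[of x "brac L y z"] show ?thesis by (rule sums_unique2)
qed

lemma lie_hom_exp_ad_self: "lie_hom L L (exp_ad L x)"
  by (simp add: lie_hom_iff[OF lie_algebra_axioms lie_algebra_axioms]
      exp_ad_add exp_ad_scal exp_ad_brac)

text \<open>Expanding the inner argument in a basis reduces the product of the two exponential series to
  Cauchy products of a scalar series with a vector series.\<close>

lemma exp_ad_minus: "exp_ad L x (exp_ad L (- x) y) = y"
proof -
  let ?D = "\<lambda>k. brac L x ^^ k"
  let ?z = "exp_ad L (- x) y"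
  \<comment> \<open>the terms of the series of \<open>exp_ad L (- x) y\<close>, rewritten with powers of \<open>brac L x\<close>\<close>
  define d where "d k = ((- 1) ^ k / fact k) *\<^sub>R ?D k y" for k
  have pow: "(brac L (- x) ^^ k) y = (- 1) ^ k *\<^sub>R ?D k y" for k
    by (induction k) (auto simp: brac_minus_left linear_neg[OF linear_brac_right] linear_cmul[OF linear_brac_right])
  have d_eq: "(brac L (- x) ^^ k) y /\<^sub>R fact k = d k" for k
    by (simp add: d_def pow divide_inverse mult.commute)
  have sd: "summable (\<lambda>k. norm (d k))" and dz: "(\<Sum>k. d k) = ?z"
    using summable_norm_exp_ad[of "-x" y] by (simp_all add: d_eq exp_ad_def)
  have sdb: "summable (\<lambda>k. norm (d k \<bullet> b))" if "b \<in> Basis" for b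
    using that Basis_le_norm by (auto intro!: summable_comparison_test'[OF sd, of 0])
  have zb: "(\<Sum>k. d k \<bullet> b) = ?z \<bullet> b" for b
    unfolding dz[symmetric] by (rule bounded_linear.suminf[OF bounded_linear_inner_left summable_norm_cancel[OF sd], symmetric])
  have bl: "bilinear (scaleR :: real \<Rightarrow> 'a \<Rightarrow> 'a)"
    by (simp add: bilinear_conv_bounded_bilinear bounded_bilinear_scaleR)
  have "(\<lambda>n. \<Sum>k\<le>n. (d k \<bullet> b) *\<^sub>R (?D (n - k) b /\<^sub>R fact (n - k))) sums ((?z \<bullet> b) *\<^sub>R exp_ad L x b)"
    if "b \<in> Basis" for b
    using Cauchy_product_bilinear[OF bl sdb[OF that] summable_norm_exp_ad[of x b]]
    unfolding zb suminf_exp_ad .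
  then have "(\<lambda>n. \<Sum>b\<in>Basis. \<Sum>k\<le>n. (d k \<bullet> b) *\<^sub>R (?D (n - k) b /\<^sub>R fact (n - k)))
      sums (\<Sum>b\<in>Basis. (?z \<bullet> b) *\<^sub>R exp_ad L x b)"
    by (rule sums_sum)
  moreover have "(\<Sum>b\<in>Basis. (?z \<bullet> b) *\<^sub>R exp_ad L x b) = exp_ad L x ?z"
  proof -
    have lin: "linear (exp_ad L x)"
      by (rule linear_lie_hom[OF lie_algebra_axioms lie_algebra_axioms lie_hom_exp_ad_self])
    have "exp_ad L x (\<Sum>b\<in>Basis. (?z \<bullet> b) *\<^sub>R b) = (\<Sum>b\<in>Basis. (?z \<bullet> b) *\<^sub>R exp_ad L x b)"
      by (simp only: linear_sum[OF lin] linear_cmul[OF lin])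
    then show ?thesis by (simp only: euclidean_representation)
  qed
  moreover have "(\<Sum>b\<in>Basis. \<Sum>k\<le>n. (d k \<bullet> b) *\<^sub>R (?D (n - k) b /\<^sub>R fact (n - k))) =
      (if n = 0 then y else 0)" for n
  proof -
    have "(\<Sum>b\<in>Basis. \<Sum>k\<le>n. (d k \<bullet> b) *\<^sub>R (?D (n - k) b /\<^sub>R fact (n - k))) =
        (\<Sum>k\<le>n. (\<Sum>b\<in>Basis. (d k \<bullet> b) *\<^sub>R (?D (n - k) b)) /\<^sub>R fact (n - k))"
      by (subst sum.swap) (simp add: scaleR_sum_right mult.commute)
    also have "\<dots> = (\<Sum>k\<le>n. (?D (n - k) (d k)) /\<^sub>R fact (n - k))"
    proof (intro sum.cong refl arg_cong[where f = "\<lambda>v. v /\<^sub>R fact _"])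
      fix k
      have "?D (n - k) (\<Sum>b\<in>Basis. (d k \<bullet> b) *\<^sub>R b) = (\<Sum>b\<in>Basis. (d k \<bullet> b) *\<^sub>R ?D (n - k) b)"
        by (simp only: linear_sum[OF linear_ad_power] linear_cmul[OF linear_ad_power])
      then show "(\<Sum>b\<in>Basis. (d k \<bullet> b) *\<^sub>R ?D (n - k) b) = ?D (n - k) (d k)"
        by (simp only: euclidean_representation)
    qed
    also have "\<dots> = (\<Sum>k\<le>n. ((real (n choose k) * (- 1) ^ k * 1 ^ (n - k)) / fact n) *\<^sub>R ?D n y)"
    proof (intro sum.cong refl)
      fix k assume k: "k \<in> {..n}"
      have "?D (n - k) (d k) = ((- 1) ^ k / fact k) *\<^sub>R ?D (n - k + k) y"
        unfolding d_def linear_cmul[OF linear_ad_power] by (simp only: funpow_add o_apply)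
      with k have "?D (n - k) (d k) = ((- 1) ^ k / fact k) *\<^sub>R ?D n y" by simp
      moreover have "inverse (fact (n - k)) * ((- 1) ^ k / fact k) =
          (real (n choose k) * (- 1) ^ k * 1 ^ (n - k)) / fact n"
        using k by (simp add: binomial_fact field_simps)
      ultimately show "?D (n - k) (d k) /\<^sub>R fact (n - k) =
          ((real (n choose k) * (- 1) ^ k * 1 ^ (n - k)) / fact n) *\<^sub>R ?D n y" by simp
    qed
    also have "\<dots> = ((- 1 + 1) ^ n / fact n) *\<^sub>R ?D n y"
      by (simp only: binomial_ring sum_divide_distrib scaleR_sum_left)
    also have "\<dots> = (if n = 0 then y else 0)" by simp
    finally show ?thesis .
  qed
  ultimately have "(\<lambda>n. if n = 0 then y else 0) sums exp_ad L x ?z" by simp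
  moreover have "(\<lambda>n. if n = 0 then y else 0) sums y" using sums_single[of 0 "\<lambda>_. y"] by simp
  ultimately show ?thesis by (rule sums_unique2)
qed

lemma exp_ad_in_Aut: "exp_ad L x \<in> carrier (Aut L)"
proof -
  have "exp_ad L (- x) (exp_ad L x y) = y" for y using exp_ad_minus[of "- x"] by simp
  then have "bij (exp_ad L x)" using exp_ad_minus[of x]
    by (intro o_bij[of "exp_ad L (- x)"]) auto
  then show ?thesis by (simp add: carrier_Aut lie_hom_exp_ad_self)
qed

lemma exp_ad_conj:
  assumes "\<phi> \<in> carrier (Aut L)"
  shows "\<phi> \<circ> exp_ad L x \<circ> Hilbert_Choice.inv \<phi> = exp_ad L (\<phi> x)"
proof
  fix y
  have \<phi>: "lie_hom L L \<phi>" "surj \<phi>" using assms by (simp_all add: carrier_Aut bij_is_surj)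
  show "(\<phi> \<circ> exp_ad L x \<circ> Hilbert_Choice.inv \<phi>) y = exp_ad L (\<phi> x) y"
    unfolding comp_apply lie_hom_exp_ad[OF lie_algebra_axioms lie_algebra_axioms \<phi>(1)]
      surj_f_inv_f[OF \<phi>(2)] ..
qed

lemma Inn_normal: "Inn L \<lhd> Aut L"
proof -
  interpret A: group "Aut L" by (rule group_Aut[OF lie_algebra_axioms])
  have sub: "range (exp_ad L) \<subseteq> carrier (Aut L)" using exp_ad_in_Aut by auto
  have "\<phi> \<otimes>\<^bsub>Aut L\<^esub> h \<otimes>\<^bsub>Aut L\<^esub> inv\<^bsub>Aut L\<^esub> \<phi> \<in> Inn L"
    if \<phi>: "\<phi> \<in> carrier (Aut L)" and "h \<in> Inn L" for \<phi> h
  proof -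
    have conj: "\<phi> \<otimes>\<^bsub>Aut L\<^esub> exp_ad L x \<otimes>\<^bsub>Aut L\<^esub> inv\<^bsub>Aut L\<^esub> \<phi> = exp_ad L (\<phi> x)" for x
      using exp_ad_conj[OF \<phi>] by (simp add: mult_Aut inv_Aut[OF lie_algebra_axioms \<phi>])
    from \<open>h \<in> Inn L\<close> show ?thesis unfolding Inn_def
    proof induction
      case one
      then show ?case using \<phi> by (simp add: generate.one)
    next
      case (incl h)
      then show ?case using conj by (auto intro: generate.incl)
    next
      case (inv h)
      then obtain x where h: "h = exp_ad L x" by blast
      then have "\<phi> \<otimes>\<^bsub>Aut L\<^esub> inv\<^bsub>Aut L\<^esub> h \<otimes>\<^bsub>Aut L\<^esub> inv\<^bsub>Aut L\<^esub> \<phi> = inv\<^bsub>Aut L\<^esub> (exp_ad L (\<phi> x))"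
        unfolding conj[symmetric] using \<phi> exp_ad_in_Aut by (simp add: A.inv_mult_group A.m_assoc)
      then show ?case by (auto intro: generate.inv)
    next
      case (eng h1 h2)
      have "h1 \<in> carrier (Aut L)" "h2 \<in> carrier (Aut L)"
        using A.generate_in_carrier[OF sub] eng by auto
      then have "\<phi> \<otimes>\<^bsub>Aut L\<^esub> (h1 \<otimes>\<^bsub>Aut L\<^esub> h2) \<otimes>\<^bsub>Aut L\<^esub> inv\<^bsub>Aut L\<^esub> \<phi> =
          (\<phi> \<otimes>\<^bsub>Aut L\<^esub> h1 \<otimes>\<^bsub>Aut L\<^esub> inv\<^bsub>Aut L\<^esub> \<phi>) \<otimes>\<^bsub>Aut L\<^esub> (\<phi> \<otimes>\<^bsub>Aut L\<^esub> h2 \<otimes>\<^bsub>Aut L\<^esub> inv\<^bsub>Aut L\<^esub> \<phi>)"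
        using \<phi> by (simp add: A.m_assoc A.inv_solve_left)
      with generate.eng[OF eng.IH] show ?case by simp
    qed
  qed
  then show ?thesis
    unfolding A.normal_inv_iff using A.generate_is_subgroup[OF sub] by (auto simp: Inn_def)
qed

end

section \<open>Outer automorphisms and twisting\<close>

context lie_algebra
begin

lemma Aut_id: "id \<in> carrier (Aut L)"
  by (simp add: carrier_Aut lie_hom_id lie_algebra_axioms)

lemma Aut_comp: "\<phi> \<in> carrier (Aut L) \<Longrightarrow> \<psi> \<in> carrier (Aut L) \<Longrightarrow> \<phi> \<circ> \<psi> \<in> carrier (Aut L)"
  using lie_algebra_axioms by (auto simp: carrier_Aut bij_comp intro: lie_hom_comp)

lemma Aut_inv: "\<phi> \<in> carrier (Aut L) \<Longrightarrow> Hilbert_Choice.inv \<phi> \<in> carrier (Aut L)"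
  using lie_algebra_axioms by (simp add: carrier_Aut lie_hom_inv bij_imp_bij_inv)

lemma Aut_inv_apply:
  assumes "\<phi> \<in> carrier (Aut L)"
  shows "\<phi> (Hilbert_Choice.inv \<phi> x) = x" "Hilbert_Choice.inv \<phi> (\<phi> x) = x"
  using assms by (simp_all add: carrier_Aut bij_is_inj bij_is_surj surj_f_inv_f)

lemma Aut_inv_comp:
  assumes "\<phi> \<in> carrier (Aut L)"
  shows "\<phi> \<circ> Hilbert_Choice.inv \<phi> = id" "Hilbert_Choice.inv \<phi> \<circ> \<phi> = id"
  using Aut_inv_apply[OF assms] by auto

lemma Inn_Aut: "u \<in> Inn L \<Longrightarrow> u \<in> carrier (Aut L)"
  using normal.axioms(1)[OF Inn_normal] subgroup.subset by blast

lemma Inn_inv: "u \<in> Inn L \<Longrightarrow> Hilbert_Choice.inv u \<in> Inn L"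
  using subgroup.m_inv_closed[OF normal.axioms(1)[OF Inn_normal]]
  by (metis Inn_Aut inv_Aut lie_algebra_axioms)

lemma Inn_conj:
  assumes "u \<in> Inn L" "\<phi> \<in> carrier (Aut L)"
  shows "\<phi> \<circ> u \<circ> Hilbert_Choice.inv \<phi> \<in> Inn L"
  using normal.inv_op_closed2[OF Inn_normal assms(2,1)] assms
  by (simp add: inv_Aut lie_algebra_axioms mult_Aut)

lemma group_Out: "group (Out L)"
  unfolding Out_def by (rule normal.factorgroup_is_group[OF Inn_normal])

lemma carrier_Out: "carrier (Out L) = out_class L ` carrier (Aut L)"
  unfolding Out_def carrier_FactGroup out_class_def by simp

lemma out_class_comp:
  assumes "\<phi> \<in> carrier (Aut L)" "\<psi> \<in> carrier (Aut L)"
  shows "out_class L (\<phi> \<circ> \<psi>) = out_class L \<phi> \<otimes>\<^bsub>Out L\<^esub> out_class L \<psi>"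
  using normal.rcos_sum[OF Inn_normal assms]
  by (simp add: out_class_def Out_def mult_Aut)

lemma out_class_hom: "group_hom (Aut L) (Out L) (out_class L)"
  using group_Aut[OF lie_algebra_axioms] group_Out
  by (auto simp: group_hom_def group_hom_axioms_def hom_def carrier_Out out_class_comp mult_Aut)

lemma out_class_inv:
  assumes "\<phi> \<in> carrier (Aut L)"
  shows "out_class L (Hilbert_Choice.inv \<phi>) = inv\<^bsub>Out L\<^esub> out_class L \<phi>"
  using group_hom.hom_inv[OF out_class_hom assms] assms
  by (simp add: inv_Aut lie_algebra_axioms)

lemma out_class_Inn:
  assumes "u \<in> Inn L" "\<phi> \<in> carrier (Aut L)"
  shows "out_class L (u \<circ> \<phi>) = out_class L \<phi>"
proof -
  interpret A: group "Aut L" by (rule group_Aut[OF lie_algebra_axioms])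
  have s: "subgroup (Inn L) (Aut L)" by (rule normal.axioms(1)[OF Inn_normal])
  have "u \<circ> \<phi> \<in> Inn L #>\<^bsub>Aut L\<^esub> \<phi>"
    using assms by (auto simp: r_coset_def mult_Aut)
  then show ?thesis unfolding out_class_def using A.repr_independence[OF _ assms(2) s] by simp
qed

lemma out_class_eqD:
  assumes "\<phi> \<in> carrier (Aut L)" "out_class L \<phi> = out_class L \<psi>"
  shows "\<exists>u\<in>Inn L. \<phi> = u \<circ> \<psi>"
proof -
  interpret A: group "Aut L" by (rule group_Aut[OF lie_algebra_axioms])
  have s: "subgroup (Inn L) (Aut L)" by (rule normal.axioms(1)[OF Inn_normal])
  have "\<phi> \<in> Inn L #>\<^bsub>Aut L\<^esub> \<phi>" by (rule A.rcos_self[OF assms(1) s])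
  with assms(2) show ?thesis by (auto simp: out_class_def r_coset_def mult_Aut)
qed

lemma Aut_over_Aut: "\<phi> \<in> Aut_over L \<Sigma> \<Longrightarrow> \<phi> \<in> carrier (Aut L)"
  by (simp add: Aut_over_def)

lemma subgroup_Aut_iff:
  "subgroup G (Aut L) \<longleftrightarrow> G \<subseteq> carrier (Aut L) \<and> id \<in> G \<and> (\<forall>\<phi>\<in>G. \<forall>\<psi>\<in>G. \<phi> \<circ> \<psi> \<in> G) \<and>
    (\<forall>\<phi>\<in>G. Hilbert_Choice.inv \<phi> \<in> G)" (is "?l \<longleftrightarrow> ?r")
proof
  assume ?l
  then show ?r
    using subgroup.m_closed[OF \<open>?l\<close>] subgroup.m_inv_closed[OF \<open>?l\<close>] subgroup.one_closed[OF \<open>?l\<close>]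
      subgroup.subset[OF \<open>?l\<close>] inv_Aut[OF lie_algebra_axioms]
    by (metis mult_Aut one_Aut subsetD)
next
  assume ?r
  then show ?l
    by (intro subgroup.intro) (auto simp: mult_Aut one_Aut inv_Aut[OF lie_algebra_axioms])
qed

lemma Aut_over_subgroup:
  assumes "subgroup \<Sigma> (Out L)"
  shows "subgroup (Aut_over L \<Sigma>) (Aut L)"
proof -
  have "out_class L id = \<one>\<^bsub>Out L\<^esub>"
    using group_hom.hom_one[OF out_class_hom] by (simp add: one_Aut)
  then show ?thesis
    unfolding subgroup_Aut_iff Aut_over_def
    using subgroup.m_closed[OF assms] subgroup.m_inv_closed[OF assms] subgroup.one_closed[OF assms]
    by (auto simp: Aut_id Aut_comp Aut_inv out_class_comp out_class_inv)
qed

lemma out_class_Aut_over: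
  assumes "subgroup \<Sigma> (Out L)"
  shows "out_class L ` Aut_over L \<Sigma> = \<Sigma>"
  using subgroup.subset[OF assms] by (auto simp: carrier_Out Aut_over_def)

lemma Aut_over_stab_subgroup:
  assumes "subgroup \<Sigma> (Out L)"
  shows "subgroup (Aut_over_stab L \<Sigma> h) (Aut L)"
proof -
  have *: "(Hilbert_Choice.inv \<phi>) ` h = h" if "\<phi> \<in> carrier (Aut L)" "\<phi> ` h = h" for \<phi>
    using that by (metis carrier_Aut bij_is_inj image_inv_f_f)
  have **: "(\<phi> \<circ> \<psi>) ` h = h" if "\<phi> ` h = h" "\<psi> ` h = h" for \<phi> \<psi> :: "'a \<Rightarrow> 'a"
    using that by (metis image_comp)
  show ?thesis
    using Aut_over_subgroup[OF assms] * ** unfolding subgroup_Aut_iff Aut_over_stab_def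
    by (simp add: subset_iff)
qed

lemma Sigma_invariant_decomp:
  assumes "subgroup \<Sigma> (Out L)" "Sigma_invariant L \<Sigma> h" "\<phi> \<in> Aut_over L \<Sigma>"
  obtains u g where "u \<in> Inn L" "g \<in> Aut_over_stab L \<Sigma> h" "\<phi> = u \<circ> g"
proof -
  have "out_class L \<phi> \<in> out_class L ` Aut_over_stab L \<Sigma> h"
    using assms unfolding Sigma_invariant_def by (simp add: Aut_over_def)
  then obtain g where g: "g \<in> Aut_over_stab L \<Sigma> h" "out_class L \<phi> = out_class L g" by blast
  from out_class_eqD[OF Aut_over_Aut[OF assms(3)] g(2)] g(1) that show ?thesis by blast
qed

lemma twist_Sigma_iff:
  assumes "subgroup \<Sigma> (Out L)" "\<Phi> \<in> carrier (Aut L)" "\<theta> \<in> carrier (Aut L)"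
  shows "out_class L \<theta> \<in> twist_Sigma L \<Phi> \<Sigma> \<longleftrightarrow> Hilbert_Choice.inv \<Phi> \<circ> \<theta> \<circ> \<Phi> \<in> Aut_over L \<Sigma>"
proof -
  interpret O: group "Out L" by (rule group_Out)
  have c: "out_class L \<Phi> \<in> carrier (Out L)" "out_class L \<theta> \<in> carrier (Out L)"
    using assms carrier_Out by auto
  have "Hilbert_Choice.inv \<Phi> \<circ> \<theta> \<circ> \<Phi> \<in> Aut_over L \<Sigma> \<longleftrightarrow>
     inv\<^bsub>Out L\<^esub> out_class L \<Phi> \<otimes>\<^bsub>Out L\<^esub> out_class L \<theta> \<otimes>\<^bsub>Out L\<^esub> out_class L \<Phi> \<in> \<Sigma>"
    using assms by (simp add: Aut_over_def Aut_comp Aut_inv out_class_comp out_class_inv)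
  moreover have "out_class L \<theta> = out_class L \<Phi> \<otimes>\<^bsub>Out L\<^esub> \<sigma> \<otimes>\<^bsub>Out L\<^esub> inv\<^bsub>Out L\<^esub> out_class L \<Phi> \<longleftrightarrow>
     inv\<^bsub>Out L\<^esub> out_class L \<Phi> \<otimes>\<^bsub>Out L\<^esub> out_class L \<theta> \<otimes>\<^bsub>Out L\<^esub> out_class L \<Phi> = \<sigma>"
    if "\<sigma> \<in> \<Sigma>" for \<sigma>
  proof -
    have s: "\<sigma> \<in> carrier (Out L)" using that subgroup.subset[OF assms(1)] by blast
    show ?thesis using c s
      by (metis O.inv_closed O.inv_solve_left O.inv_solve_right O.m_assoc O.m_closed)
  qed
  ultimately show ?thesis by (auto simp: twist_Sigma_def)
qed

text \<open>If \<open>m\<close> is \<open>\<Sigma>\<close>-invariant, the conjugated stabilizer of \<open>m\<close> maps onto the twisted \<open>\<Sigma>\<close>.\<close>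

lemma twist_Sigma_decomp:
  assumes "subgroup \<Sigma> (Out L)" "Sigma_invariant L \<Sigma> m" "\<Phi> \<in> carrier (Aut L)"
    and "\<theta> \<in> carrier (Aut L)" "out_class L \<theta> \<in> twist_Sigma L \<Phi> \<Sigma>"
  obtains u g where "u \<in> Inn L" "g \<in> Aut_over_stab L \<Sigma> m"
    "\<Phi> \<circ> g \<circ> Hilbert_Choice.inv \<Phi> = u \<circ> \<theta>"
proof -
  have "Hilbert_Choice.inv \<Phi> \<circ> \<theta> \<circ> \<Phi> \<in> Aut_over L \<Sigma>"
    using assms twist_Sigma_iff by blast
  from Sigma_invariant_decomp[OF assms(1,2) this] obtain v g where
    vg: "v \<in> Inn L" "g \<in> Aut_over_stab L \<Sigma> m" "Hilbert_Choice.inv \<Phi> \<circ> \<theta> \<circ> \<Phi> = v \<circ> g" by metis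
  define u where "u = \<Phi> \<circ> Hilbert_Choice.inv v \<circ> Hilbert_Choice.inv \<Phi>"
  have "u \<in> Inn L" unfolding u_def using vg assms by (intro Inn_conj Inn_inv)
  moreover have "\<Phi> (g (Hilbert_Choice.inv \<Phi> x)) = u (\<theta> x)" for x
  proof -
    have "v (g (Hilbert_Choice.inv \<Phi> x)) = Hilbert_Choice.inv \<Phi> (\<theta> x)"
      using fun_cong[OF vg(3), of "Hilbert_Choice.inv \<Phi> x"] by (simp add: Aut_inv_apply[OF assms(3)])
    then have "g (Hilbert_Choice.inv \<Phi> x) = Hilbert_Choice.inv v (Hilbert_Choice.inv \<Phi> (\<theta> x))"
      by (metis Aut_inv_apply(2) Inn_Aut vg(1))
    then show ?thesis by (simp add: u_def)
  qed
  ultimately show ?thesis using that[of u g] vg(2) by fastforce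
qed

lemma twist_Sigma_conj:
  assumes "subgroup \<Sigma> (Out L)" "\<Phi> \<in> carrier (Aut L)" "g \<in> Aut_over L \<Sigma>"
  shows "out_class L (\<Phi> \<circ> g \<circ> Hilbert_Choice.inv \<Phi>) \<in> twist_Sigma L \<Phi> \<Sigma>"
  using assms by (subst out_class_comp, simp_all add: Aut_over_def Aut_comp Aut_inv
      out_class_comp out_class_inv) (auto simp: twist_Sigma_def)

section \<open>Subalgebras that are maximal among the invariant ones\<close>

text \<open>The part of primitivity that the structure theorem uses, for an arbitrary set \<open>G\<close> of
  automorphisms in place of the stabilizer.\<close>

definition maximal_invariant :: "('a \<Rightarrow> 'a) set \<Rightarrow> 'a set \<Rightarrow> bool" where
  "maximal_invariant G m \<longleftrightarrow> lie_subalgebra L m \<and> m \<noteq> UNIV \<and> (\<forall>g\<in>G. g ` m = m) \<and>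
     (\<forall>m'. lie_subalgebra L m' \<and> (\<forall>g\<in>G. g ` m' = m') \<and> m \<subseteq> m' \<longrightarrow> m' = m \<or> m' = UNIV)"

lemma maximal_invariantD:
  assumes "maximal_invariant G m"
  shows "lie_subalgebra L m" "m \<noteq> UNIV" "g \<in> G \<Longrightarrow> g ` m = m"
    "lie_subalgebra L m' \<Longrightarrow> (\<And>g. g \<in> G \<Longrightarrow> g ` m' = m') \<Longrightarrow> m \<subseteq> m' \<Longrightarrow> m' = m \<or> m' = UNIV"
  using assms unfolding maximal_invariant_def by auto

lemma Sigma_primitive_maximal_invariant:
  assumes "Sigma_primitive L \<Sigma> m"
  shows "maximal_invariant (Aut_over_stab L \<Sigma> m) m"
  using assms by (auto simp: Sigma_primitive_def maximal_invariant_def Aut_over_stab_def)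

lemma subgroup_image_eqI:
  assumes "subgroup G (Aut L)" "\<And>g. g \<in> G \<Longrightarrow> g ` h \<subseteq> h" "g \<in> G"
  shows "g ` h = h"
proof
  have "Hilbert_Choice.inv g \<in> G" "g \<in> carrier (Aut L)"
    using assms(1,3) by (auto simp: subgroup_Aut_iff)
  then show "h \<subseteq> g ` h" using assms(2) Aut_inv_apply(1)
    by (metis image_eqI image_subset_iff subsetI)
qed (use assms in blast)

lemma subalgebra_image:
  assumes "\<phi> \<in> carrier (Aut L)" "lie_subalgebra L h"
  shows "lie_subalgebra L (\<phi> ` h)"
proof -
  have \<phi>: "\<phi> (x + y) = \<phi> x + \<phi> y" "\<phi> (scal L c x) = scal L c (\<phi> x)"
    "\<phi> (brac L x y) = brac L (\<phi> x) (\<phi> y)" for x y c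
    using assms(1) lie_algebra_axioms by (auto simp: carrier_Aut lie_hom_iff)
  have "\<phi> 0 = 0" using \<phi>(1)[of 0 0] by simp
  then show ?thesis
    using assms(2) unfolding lie_subalgebra_iff
    by (auto simp: \<phi>[symmetric])
qed

lemma maximal_invariant_conj:
  assumes "G \<subseteq> carrier (Aut L)" "maximal_invariant G m" "\<Phi> \<in> carrier (Aut L)"
  shows "maximal_invariant ((\<lambda>g. \<Phi> \<circ> g \<circ> Hilbert_Choice.inv \<Phi>) ` G) (\<Phi> ` m)"
proof -
  let ?\<Psi> = "Hilbert_Choice.inv \<Phi>"
  note \<Phi> = Aut_inv_apply[OF assms(3)]
  have im: "?\<Psi> ` \<Phi> ` X = X" "\<Phi> ` ?\<Psi> ` X = X" for X
    by (auto simp: image_iff \<Phi>)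
  have U: "X = UNIV" if "\<Phi> ` X = UNIV \<or> ?\<Psi> ` X = UNIV" for X
    using that im[of X] assms(3) Aut_inv[OF assms(3)] by (metis carrier_Aut bij_is_surj)
  have conj: "(\<Phi> \<circ> g \<circ> ?\<Psi>) ` X = \<Phi> ` g ` ?\<Psi> ` X" for g X by (simp add: image_comp comp_assoc)
  have "m' = \<Phi> ` m \<or> m' = UNIV"
    if "lie_subalgebra L m'" and inv: "\<forall>g\<in>G. (\<Phi> \<circ> g \<circ> ?\<Psi>) ` m' = m'" and sub: "\<Phi> ` m \<subseteq> m'" for m'
  proof -
    have "lie_subalgebra L (?\<Psi> ` m')" by (intro subalgebra_image Aut_inv assms that)
    moreover have "g ` ?\<Psi> ` m' = ?\<Psi> ` m'" if "g \<in> G" for g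
      using inv that unfolding conj by (metis im(1))
    moreover have "m \<subseteq> ?\<Psi> ` m'" using image_mono[OF sub, of ?\<Psi>] unfolding im .
    ultimately have "?\<Psi> ` m' = m \<or> ?\<Psi> ` m' = UNIV"
      by (rule maximal_invariantD(4)[OF assms(2)])
    then show ?thesis using U im by metis
  qed
  moreover have "\<Phi> ` m \<noteq> UNIV" using U maximal_invariantD(2)[OF assms(2)] by blast
  moreover have "lie_subalgebra L (\<Phi> ` m)"
    by (rule subalgebra_image[OF assms(3) maximal_invariantD(1)[OF assms(2)]])
  moreover have "\<forall>g\<in>G. (\<Phi> \<circ> g \<circ> ?\<Psi>) ` \<Phi> ` m = \<Phi> ` m"
    unfolding conj im using maximal_invariantD(3)[OF assms(2)] by metis
  ultimately show ?thesis unfolding maximal_invariant_def by (simp only: ball_simps) blast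
qed

lemma subgroup_conj:
  assumes "subgroup G (Aut L)" "\<Phi> \<in> carrier (Aut L)"
  shows "subgroup ((\<lambda>g. \<Phi> \<circ> g \<circ> Hilbert_Choice.inv \<Phi>) ` G) (Aut L)"
proof -
  note \<Phi> = Aut_inv_apply[OF assms(2)]
  have G: "G \<subseteq> carrier (Aut L)" "id \<in> G" "\<And>\<phi> \<psi>. \<phi> \<in> G \<Longrightarrow> \<psi> \<in> G \<Longrightarrow> \<phi> \<circ> \<psi> \<in> G"
    "\<And>\<phi>. \<phi> \<in> G \<Longrightarrow> Hilbert_Choice.inv \<phi> \<in> G"
    using assms(1) by (auto simp: subgroup_Aut_iff)
  define c where "c g = \<Phi> \<circ> g \<circ> Hilbert_Choice.inv \<Phi>" for g
  have "Hilbert_Choice.inv (c g) = c (Hilbert_Choice.inv g)" if "g \<in> G" for g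
    unfolding c_def
    by (rule inv_unique_comp) (use that G \<Phi> Aut_inv_apply[of g] in \<open>auto simp: fun_eq_iff\<close>)
  then have inv: "Hilbert_Choice.inv (c g) \<in> c ` G" if "g \<in> G" for g
    using that G(4) by simp
  have one: "id \<in> c ` G" using \<Phi> G(2) by (intro image_eqI[of _ _ id]) (auto simp: c_def)
  have "c g \<circ> c h = c (g \<circ> h)" for g h using \<Phi> by (auto simp: c_def)
  then have comp: "c g \<circ> c h \<in> c ` G" if "g \<in> G" "h \<in> G" for g h
    using that G(3) by simp
  have "c ` G \<subseteq> carrier (Aut L)" unfolding c_def using G assms(2) by (blast intro: Aut_comp Aut_inv)
  with inv one comp have "subgroup (c ` G) (Aut L)" unfolding subgroup_Aut_iff by blast
  then show ?thesis by (simp only: c_def[abs_def])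
qed

end

section \<open>Automorphisms of a direct power\<close>

text \<open>\<open>L\<close> is the direct sum of \<open>n\<close> copies of the simple algebra \<open>S\<close>; \<open>n = 0\<close> is not excluded.\<close>

locale lie_power = L: lie_algebra L + S: lie_algebra S
  for L :: "('k::real_normed_field, 'a::euclidean_space) lie_struct"
    and S :: "('k, 'b::euclidean_space) lie_struct"
    and n :: nat and \<kappa> :: "'a \<Rightarrow> nat \<Rightarrow> 'b" +
  assumes simple: "lie_simple S" and power: "direct_power L S n \<kappa>"
begin

lemma \<kappa>_hom: "i \<in> {1..n} \<Longrightarrow> lie_hom L S (\<lambda>X. \<kappa> X i)"
  using power by (auto simp: direct_power_def)

lemma \<kappa>_add: "i \<in> {1..n} \<Longrightarrow> \<kappa> (X + Y) i = \<kappa> X i + \<kappa> Y i"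
  and \<kappa>_scal: "i \<in> {1..n} \<Longrightarrow> \<kappa> (scal L c X) i = scal S c (\<kappa> X i)"
  and \<kappa>_brac: "i \<in> {1..n} \<Longrightarrow> \<kappa> (brac L X Y) i = brac S (\<kappa> X i) (\<kappa> Y i)"
  using \<kappa>_hom[of i] by (simp_all add: lie_hom_iff L.lie_algebra_axioms S.lie_algebra_axioms)

lemma \<kappa>_zero: "i \<in> {1..n} \<Longrightarrow> \<kappa> 0 i = 0"
  and \<kappa>_diff: "i \<in> {1..n} \<Longrightarrow> \<kappa> (X - Y) i = \<kappa> X i - \<kappa> Y i"
  using linear_0[OF linear_lie_hom[OF L.lie_algebra_axioms S.lie_algebra_axioms \<kappa>_hom]]
    linear_diff[OF linear_lie_hom[OF L.lie_algebra_axioms S.lie_algebra_axioms \<kappa>_hom]] by blast+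

lemma \<kappa>_eqI: "(\<And>i. i \<in> {1..n} \<Longrightarrow> \<kappa> X i = \<kappa> Y i) \<Longrightarrow> X = Y"
proof -
  assume "\<And>i. i \<in> {1..n} \<Longrightarrow> \<kappa> X i = \<kappa> Y i"
  then have "restrict (\<kappa> X) {1..n} = restrict (\<kappa> Y) {1..n}" by (rule restrict_ext)
  moreover have "inj (\<lambda>X. restrict (\<kappa> X) {1..n})"
    using power by (auto simp: direct_power_def bij_betw_def)
  ultimately show ?thesis by (auto dest: injD)
qed

lemma ex_coords: "\<exists>X. \<forall>i\<in>{1..n}. \<kappa> X i = Y i"
proof -
  have "restrict Y {1..n} \<in> (\<lambda>X. restrict (\<kappa> X) {1..n}) ` UNIV"
    using power by (auto simp: direct_power_def bij_betw_def)
  then obtain X where "restrict Y {1..n} = restrict (\<kappa> X) {1..n}" by auto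
  then show ?thesis by (metis restrict_apply')
qed

text \<open>The element whose \<open>i\<close>-th component is \<open>Y i\<close>; the choice is unique, and values of \<open>Y\<close> outside
  \<open>{1..n}\<close> are ignored.\<close>

definition tuple :: "(nat \<Rightarrow> 'b) \<Rightarrow> 'a" where
  "tuple Y = (SOME X. \<forall>i\<in>{1..n}. \<kappa> X i = Y i)"

lemma \<kappa>_tuple [simp]: "i \<in> {1..n} \<Longrightarrow> \<kappa> (tuple Y) i = Y i"
  using someI_ex[OF ex_coords[of Y]] by (simp add: tuple_def)

lemma S_Aut_iff: "f \<in> carrier (Aut S) \<longleftrightarrow> (\<forall>x y. f (x + y) = f x + f y) \<and>
    (\<forall>c x. f (scal S c x) = scal S c (f x)) \<and> (\<forall>x y. f (brac S x y) = brac S (f x) (f y)) \<and> bij f"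
  by (simp add: carrier_Aut lie_hom_iff S.lie_algebra_axioms)

lemma L_Aut_iff: "f \<in> carrier (Aut L) \<longleftrightarrow> (\<forall>x y. f (x + y) = f x + f y) \<and>
    (\<forall>c x. f (scal L c x) = scal L c (f x)) \<and> (\<forall>x y. f (brac L x y) = brac L (f x) (f y)) \<and> bij f"
  by (simp add: carrier_Aut lie_hom_iff L.lie_algebra_axioms)

lemma S_Aut_zero: "f \<in> carrier (Aut S) \<Longrightarrow> f x = 0 \<longleftrightarrow> x = 0"
  by (metis S_Aut_iff add_cancel_left_left bij_pointE)

lemma S_nontrivial: obtains x y where "brac S x y \<noteq> 0" "x \<noteq> 0"
  using lie_simple_nontrivial[OF S.lie_algebra_axioms simple] by blast

lemma S_Aut_surjI:
  assumes "\<And>x y. f (x + y) = f x + f y" "\<And>c x. f (scal S c x) = scal S c (f x)"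
    "\<And>x y. f (brac S x y) = brac S (f x) (f y)" "surj f"
  shows "f \<in> carrier (Aut S)"
  unfolding carrier_Aut using assms
  by (auto simp: lie_hom_iff S.lie_algebra_axioms intro!: lie_simple_surj_bij[OF S.lie_algebra_axioms simple])

lemma permD: "\<pi> permutes {1..n} \<Longrightarrow> \<pi> i \<in> {1..n} \<longleftrightarrow> i \<in> {1..n}"
  by (rule permutes_in_image)

lemma aut_componentsD:
  assumes "aut_components S n \<kappa> \<phi> \<phi>s \<pi>"
  shows "\<pi> permutes {1..n}" "i \<in> {1..n} \<Longrightarrow> \<phi>s i \<in> carrier (Aut S)"
    "i \<in> {1..n} \<Longrightarrow> \<kappa> (\<phi> X) i = \<phi>s i (\<kappa> X (\<pi> i))" "i \<in> {1..n} \<Longrightarrow> \<pi> i \<in> {1..n}"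
  using assms permD unfolding aut_components_def by auto

text \<open>Every choice of components is realized by an automorphism of \<open>L\<close>.\<close>

lemma ex_Aut_components:
  assumes "\<pi> permutes {1..n}" "\<And>i. i \<in> {1..n} \<Longrightarrow> \<phi>s i \<in> carrier (Aut S)"
  shows "\<exists>\<phi>\<in>carrier (Aut L). aut_components S n \<kappa> \<phi> \<phi>s \<pi>"
proof (intro bexI)
  let ?\<phi> = "\<lambda>X. tuple (\<lambda>i. \<phi>s i (\<kappa> X (\<pi> i)))"
  let ?\<rho> = "Hilbert_Choice.inv \<pi>"
  let ?\<psi> = "\<lambda>X. tuple (\<lambda>j. Hilbert_Choice.inv (\<phi>s (?\<rho> j)) (\<kappa> X (?\<rho> j)))"
  note \<pi> = permutes_inverses[OF assms(1)]
  have in1: "\<pi> i \<in> {1..n}" "?\<rho> i \<in> {1..n}" if "i \<in> {1..n}" for i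
    using that permD[OF assms(1)] permD[OF permutes_inv[OF assms(1)]] by auto
  show "aut_components S n \<kappa> ?\<phi> \<phi>s \<pi>"
    using assms by (simp add: aut_components_def)
  have f: "\<phi>s i (x + y) = \<phi>s i x + \<phi>s i y" "\<phi>s i (scal S c x) = scal S c (\<phi>s i x)"
    "\<phi>s i (brac S x y) = brac S (\<phi>s i x) (\<phi>s i y)" if "i \<in> {1..n}" for i x y c
    using assms(2)[OF that] S_Aut_iff by auto
  have "?\<psi> (?\<phi> X) = X" "?\<phi> (?\<psi> X) = X" for X
    by (rule \<kappa>_eqI, use in1 in \<open>simp add: \<pi> S.Aut_inv_apply[OF assms(2)]\<close>)+
  then have "bij ?\<phi>" by (intro o_bij[of ?\<psi>]) auto
  moreover have "?\<phi> (X + Y) = ?\<phi> X + ?\<phi> Y" "?\<phi> (scal L c X) = scal L c (?\<phi> X)"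
    "?\<phi> (brac L X Y) = brac L (?\<phi> X) (?\<phi> Y)" for X Y c
    by (rule \<kappa>_eqI, use in1 f in \<open>simp add: \<kappa>_add \<kappa>_scal \<kappa>_brac\<close>)+
  ultimately show "?\<phi> \<in> carrier (Aut L)"
    unfolding L_Aut_iff by blast
qed

lemma aut_components_comp:
  assumes "aut_components S n \<kappa> \<phi> \<phi>s \<pi>" "aut_components S n \<kappa> \<psi> \<psi>s \<rho>"
  shows "aut_components S n \<kappa> (\<phi> \<circ> \<psi>) (\<lambda>i. \<phi>s i \<circ> \<psi>s (\<pi> i)) (\<rho> \<circ> \<pi>)"
  using assms permD[of \<pi>] unfolding aut_components_def
  by (auto intro!: permutes_compose S.Aut_comp)

lemma aut_components_inv:
  assumes "\<phi> \<in> carrier (Aut L)" "aut_components S n \<kappa> \<phi> \<phi>s \<pi>"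
  shows "aut_components S n \<kappa> (Hilbert_Choice.inv \<phi>)
    (\<lambda>j. Hilbert_Choice.inv (\<phi>s (Hilbert_Choice.inv \<pi> j))) (Hilbert_Choice.inv \<pi>)"
proof -
  let ?\<rho> = "Hilbert_Choice.inv \<pi>"
  note D = aut_componentsD[OF assms(2)]
  note \<pi> = permutes_inverses[OF D(1)]
  have in1: "?\<rho> i \<in> {1..n}" if "i \<in> {1..n}" for i
    using that permD[OF permutes_inv[OF D(1)]] by auto
  have "\<kappa> (Hilbert_Choice.inv \<phi> X) j = Hilbert_Choice.inv (\<phi>s (?\<rho> j)) (\<kappa> X (?\<rho> j))"
    if "j \<in> {1..n}" for X j
  proof -
    have "\<kappa> X (?\<rho> j) = \<phi>s (?\<rho> j) (\<kappa> (Hilbert_Choice.inv \<phi> X) j)"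
      using D(3)[OF in1[OF that], of "Hilbert_Choice.inv \<phi> X"]
      by (simp add: \<pi> L.Aut_inv_apply[OF assms(1)])
    then show ?thesis using S.Aut_inv_apply(2)[OF D(2)[OF in1[OF that]]] by simp
  qed
  then show ?thesis
    using in1 D(2) permutes_inv[OF D(1)] by (auto simp: aut_components_def intro: S.Aut_inv)
qed

text \<open>Every automorphism permutes the summands: followed by the \<open>i\<close>-th projection, \<open>\<phi>\<close> maps each
  summand onto an ideal of \<open>S\<close>. As different summands commute and \<open>S\<close> does not, exactly one of
  them is mapped onto \<open>S\<close> and all others are mapped to \<open>0\<close>.\<close>

lemma Aut_components_exist:
  assumes "\<phi> \<in> carrier (Aut L)"
  shows "\<exists>\<phi>s \<pi>. aut_components S n \<kappa> \<phi> \<phi>s \<pi>"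
proof -
  note \<phi> = assms[unfolded L_Aut_iff]
  define \<iota> where "\<iota> j x = tuple (\<lambda>i. if i = j then x else 0)" for j x
  define f where "f i j x = \<kappa> (\<phi> (\<iota> j x)) i" for i j x
  have \<iota>: "\<iota> j (x + y) = \<iota> j x + \<iota> j y" "\<iota> j (scal S c x) = scal L c (\<iota> j x)"
    "\<iota> j (brac S x y) = brac L (\<iota> j x) (\<iota> j y)" for j x y c
    by (rule \<kappa>_eqI, simp add: \<iota>_def \<kappa>_add \<kappa>_scal \<kappa>_brac)+
  have f: "f i j (x + y) = f i j x + f i j y" "f i j (scal S c x) = scal S c (f i j x)"
    "f i j (brac S x y) = brac S (f i j x) (f i j y)" if "i \<in> {1..n}" for i j x y c
    using that \<phi> by (simp_all add: f_def \<iota> \<kappa>_add \<kappa>_scal \<kappa>_brac)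
  have f0: "f i j 0 = 0" if "i \<in> {1..n}" for i j using f(1)[OF that, of j 0 0] by simp
  have surj: "\<exists>X. \<kappa> (\<phi> X) i = s" if "i \<in> {1..n}" for i s
    using \<kappa>_tuple[OF that, of "\<lambda>_. s"] \<phi> by (metis bij_pointE)
  have ideal: "lie_ideal S (range (f i j))" if i: "i \<in> {1..n}" and j: "j \<in> {1..n}" for i j
    unfolding S.lie_ideal_iff
  proof (intro conjI allI ballI)
    show "0 \<in> range (f i j)" using f0[OF i, of j] by (metis rangeI)
    fix u v c assume "u \<in> range (f i j)"
    then obtain x where x: "u = f i j x" by blast
    show "scal S c u \<in> range (f i j)" using f(2)[OF i, of j c x] x by (metis rangeI)
    obtain X where "\<kappa> (\<phi> X) i = v" using surj[OF i] by blast
    moreover have "brac L X (\<iota> j x) = \<iota> j (brac S (\<kappa> X j) x)"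
      by (rule \<kappa>_eqI) (simp add: \<iota>_def \<kappa>_brac)
    ultimately have "brac S v u = f i j (brac S (\<kappa> X j) x)"
      using i \<phi> x by (simp add: f_def flip: \<kappa>_brac) (metis \<kappa>_brac i)
    then show "brac S v u \<in> range (f i j)" by blast
  next
    fix u v assume "u \<in> range (f i j)" "v \<in> range (f i j)"
    then obtain x y where "u = f i j x" "v = f i j y" by blast
    then show "u + v \<in> range (f i j)" using f(1)[OF i, of j x y] by (metis rangeI)
  qed
  have comm: "brac S (f i j x) (f i j' y) = 0" if "i \<in> {1..n}" "j \<noteq> j'" for i j j' x y
  proof -
    have "brac L (\<iota> j x) (\<iota> j' y) = 0"
      by (rule \<kappa>_eqI) (use that in \<open>simp add: \<iota>_def \<kappa>_brac \<kappa>_zero\<close>)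
    then have "\<kappa> (\<phi> (brac L (\<iota> j x) (\<iota> j' y))) i = 0" using f0[OF that(1), of 0]
      using \<kappa>_zero[OF that(1)] \<phi> by (metis add_cancel_right_right)
    then show ?thesis using that(1) \<phi> by (simp add: f_def \<kappa>_brac)
  qed
  \<comment> \<open>\<open>X\<close> is the sum of its components, added one index at a time\<close>
  have ker: "\<kappa> (\<phi> X) i = 0" if i: "i \<in> {1..n}" and all: "\<And>j. j \<in> {1..n} \<Longrightarrow> f i j (\<kappa> X j) = 0" for i X
  proof -
    have "\<kappa> (\<phi> (tuple (\<lambda>j. if j \<in> F then \<kappa> X j else 0))) i = 0" if "finite F" "F \<subseteq> {1..n}" for F
      using that
    proof (induction F)
      case empty
      have "tuple (\<lambda>j. if j \<in> {} then \<kappa> X j else 0) = \<iota> 0 0" by (rule \<kappa>_eqI) (simp add: \<iota>_def)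
      then show ?case using f0[OF i, of 0] by (simp add: f_def)
    next
      case (insert j F)
      have "tuple (\<lambda>i. if i \<in> insert j F then \<kappa> X i else 0) =
          \<iota> j (\<kappa> X j) + tuple (\<lambda>i. if i \<in> F then \<kappa> X i else 0)"
        by (rule \<kappa>_eqI) (use insert in \<open>auto simp: \<iota>_def \<kappa>_add\<close>)
      moreover have "\<kappa> (\<phi> (\<iota> j (\<kappa> X j))) i = 0" using all[of j] insert by (simp add: f_def)
      ultimately show ?case using insert \<phi> \<kappa>_add[OF i] by simp
    qed
    from this[of "{1..n}"] have "\<kappa> (\<phi> (tuple (\<lambda>j. if j \<in> {1..n} then \<kappa> X j else 0))) i = 0" by simp
    moreover have "tuple (\<lambda>j. if j \<in> {1..n} then \<kappa> X j else 0) = X" by (rule \<kappa>_eqI) simp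
    ultimately show ?thesis by simp
  qed
  have "\<exists>j. j \<in> {1..n} \<and> f i j \<in> carrier (Aut S) \<and> (\<forall>X. \<kappa> (\<phi> X) i = f i j (\<kappa> X j))"
    if i: "i \<in> {1..n}" for i
  proof -
    obtain s :: 'b where "s \<noteq> 0" using S_nontrivial by metis
    then obtain j x where j: "j \<in> {1..n}" "f i j x \<noteq> 0" using surj[OF i, of s] ker[OF i] by metis
    then have "range (f i j) = UNIV"
      using simple ideal[OF i j(1)] unfolding lie_simple_def by blast
    then have aut: "f i j \<in> carrier (Aut S)" using f[OF i] by (intro S_Aut_surjI) auto
    have zero: "f i j' y = 0" if j': "j' \<in> {1..n}" "j' \<noteq> j" for j' y
    proof (rule ccontr)
      assume "f i j' y \<noteq> 0"
      then have "range (f i j') = UNIV"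
        using simple ideal[OF i j'(1)] unfolding lie_simple_def by blast
      then have "brac S u v = 0" for u v
        using comm[OF i j'(2)[symmetric]] \<open>range (f i j) = UNIV\<close> by (metis UNIV_I imageE)
      then show False using S_nontrivial by metis
    qed
    have "\<kappa> (\<phi> X) i = f i j (\<kappa> X j)" for X
    proof -
      let ?Y = "X - \<iota> j (\<kappa> X j)"
      have "\<kappa> (\<phi> ?Y) i = 0"
      proof (rule ker[OF i])
        fix k assume k: "k \<in> {1..n}"
        show "f i k (\<kappa> ?Y k) = 0"
          using zero[OF k] f0[OF i] k by (cases "k = j") (auto simp: \<kappa>_diff \<iota>_def)
      qed
      moreover have "\<phi> X = \<phi> ?Y + \<phi> (\<iota> j (\<kappa> X j))" using \<phi> by (metis diff_add_cancel)
      ultimately show ?thesis by (simp add: \<kappa>_add[OF i] f_def)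
    qed
    with j(1) aut show ?thesis by blast
  qed
  then obtain \<pi>0 where \<pi>0: "\<And>i. i \<in> {1..n} \<Longrightarrow> \<pi>0 i \<in> {1..n}"
    "\<And>i. i \<in> {1..n} \<Longrightarrow> f i (\<pi>0 i) \<in> carrier (Aut S)"
    "\<And>i X. i \<in> {1..n} \<Longrightarrow> \<kappa> (\<phi> X) i = f i (\<pi>0 i) (\<kappa> X (\<pi>0 i))" by metis
  define \<pi> where "\<pi> i = (if i \<in> {1..n} then \<pi>0 i else i)" for i
  have "inj_on \<pi>0 {1..n}"
  proof (rule inj_onI, rule ccontr)
    fix i i' assume i: "i \<in> {1..n}" "i' \<in> {1..n}" "\<pi>0 i = \<pi>0 i'" "i \<noteq> i'"
    obtain s :: 'b where s: "s \<noteq> 0" using S_nontrivial by metis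
    obtain X where X: "\<phi> X = tuple (\<lambda>k. if k = i then 0 else s)" using \<phi> by (metis bij_pointE)
    have "f i (\<pi>0 i) (\<kappa> X (\<pi>0 i)) = 0" using \<pi>0(3)[OF i(1), of X] i X by simp
    then have "\<kappa> X (\<pi>0 i) = 0" using S_Aut_zero[OF \<pi>0(2)[OF i(1)]] by simp
    then have "\<kappa> (\<phi> X) i' = 0" using \<pi>0(3)[OF i(2), of X] i(3) S_Aut_zero[OF \<pi>0(2)[OF i(2)]] by simp
    then show False using X i s by simp
  qed
  then have "bij_betw \<pi>0 {1..n} {1..n}"
    using \<pi>0(1) by (metis atLeastAtMost_iff endo_inj_surj bij_betw_def finite_atLeastAtMost image_subsetI)
  then have "bij_betw \<pi> {1..n} {1..n}" by (rule bij_betw_cong[THEN iffD1, rotated]) (simp add: \<pi>_def)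
  then have "\<pi> permutes {1..n}" by (rule bij_imp_permutes) (auto simp: \<pi>_def)
  then have "aut_components S n \<kappa> \<phi> (\<lambda>i. f i (\<pi>0 i)) \<pi>"
    using \<pi>0 unfolding aut_components_def by (auto simp: \<pi>_def)
  then show ?thesis by blast
qed

lemma Inn_components:
  assumes "u \<in> Inn L"
  shows "\<exists>us. aut_components S n \<kappa> u us id \<and> (\<forall>i\<in>{1..n}. us i \<in> Inn S)"
proof -
  interpret AL: group "Aut L" by (rule group_Aut[OF L.lie_algebra_axioms])
  have sub: "range (exp_ad L) \<subseteq> carrier (Aut L)" using L.exp_ad_in_Aut by auto
  have e: "aut_components S n \<kappa> (exp_ad L x) (\<lambda>i. exp_ad S (\<kappa> x i)) id" for x
    unfolding aut_components_def
    by (auto simp: S.exp_ad_in_Aut permutes_id intro!: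
        lie_hom_exp_ad[OF L.lie_algebra_axioms S.lie_algebra_axioms \<kappa>_hom])
  have eI: "exp_ad S x \<in> Inn S" for x unfolding Inn_def by (rule generate.incl) blast
  have comp: "v \<circ> w \<in> Inn S" if "v \<in> Inn S" "w \<in> Inn S" for v w
    using that generate.eng unfolding Inn_def by (metis mult_Aut)
  from assms show ?thesis unfolding Inn_def[of L]
  proof induction
    case one
    have "aut_components S n \<kappa> id (\<lambda>_. id) id"
      by (simp add: aut_components_def permutes_id S.Aut_id)
    moreover have "id \<in> Inn S" unfolding Inn_def using generate.one by (metis one_Aut)
    ultimately show ?case unfolding one_Aut by blast
  next
    case (incl h)
    then show ?case using e eI by blast
  next
    case (inv h)
    then obtain x where h: "h = exp_ad L x" by blast
    have "aut_components S n \<kappa> (Hilbert_Choice.inv h)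
       (\<lambda>i. Hilbert_Choice.inv (exp_ad S (\<kappa> x i))) id"
      using aut_components_inv[OF L.exp_ad_in_Aut e[of x]] by (simp add: h)
    then show ?case unfolding inv_Aut[OF L.lie_algebra_axioms L.exp_ad_in_Aut, of x, folded h]
      using eI S.Inn_inv by blast
  next
    case (eng h1 h2)
    then obtain us vs where
      "aut_components S n \<kappa> h1 us id" "\<forall>i\<in>{1..n}. us i \<in> Inn S"
      "aut_components S n \<kappa> h2 vs id" "\<forall>i\<in>{1..n}. vs i \<in> Inn S" by blast
    moreover from this have "aut_components S n \<kappa> (h1 \<circ> h2) (\<lambda>i. us i \<circ> vs i) id"
      using aut_components_comp[of h1 us id h2 vs id] by simp
    ultimately show ?case using comp unfolding mult_Aut by blast
  qed
qed

section \<open>Subdirect powers of a simple algebra\<close>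

text \<open>Two indices are coupled if the kernel of the first projection of \<open>m\<close> is contained in that of the
  second. If \<open>m\<close> projects onto every summand, the relation is symmetric, coupled components
  determine each other by an automorphism of \<open>S\<close>, and components in different classes are independent
  (Goursat's lemma).\<close>

definition coupled :: "'a set \<Rightarrow> nat \<Rightarrow> nat \<Rightarrow> bool" where
  "coupled m i j \<longleftrightarrow> (\<forall>X\<in>m. \<kappa> X i = 0 \<longrightarrow> \<kappa> X j = 0)"

lemma coupled_refl: "coupled m i i"
  by (simp add: coupled_def)

lemma coupled_trans: "coupled m i j \<Longrightarrow> coupled m j k \<Longrightarrow> coupled m i k"
  by (simp add: coupled_def)

lemma subalgebraD:
  assumes "lie_subalgebra L m"
  shows "0 \<in> m" "X \<in> m \<Longrightarrow> Y \<in> m \<Longrightarrow> X + Y \<in> m" "X \<in> m \<Longrightarrow> scal L c X \<in> m"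
    "X \<in> m \<Longrightarrow> Y \<in> m \<Longrightarrow> brac L X Y \<in> m" "X \<in> m \<Longrightarrow> Y \<in> m \<Longrightarrow> X - Y \<in> m"
proof -
  note s = assms[unfolded L.lie_subalgebra_iff]
  show "0 \<in> m" "X \<in> m \<Longrightarrow> Y \<in> m \<Longrightarrow> X + Y \<in> m" "X \<in> m \<Longrightarrow> scal L c X \<in> m"
    "X \<in> m \<Longrightarrow> Y \<in> m \<Longrightarrow> brac L X Y \<in> m" using s by blast+
  have "X - Y = X + scal L (- 1) Y" by (simp add: L.scale_minus_left)
  then show "X - Y \<in> m" if "X \<in> m" "Y \<in> m" using that s by metis
qed

context
  fixes m assumes m: "lie_subalgebra L m" and onto: "\<And>i. i \<in> {1..n} \<Longrightarrow> (\<lambda>X. \<kappa> X i) ` m = UNIV"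
begin

lemma coupled_iso:
  assumes "i \<in> {1..n}" "j \<in> {1..n}" "coupled m i j"
  shows "\<exists>\<theta>\<in>carrier (Aut S). \<forall>X\<in>m. \<kappa> X j = \<theta> (\<kappa> X i)"
proof -
  have "\<exists>t. \<forall>X\<in>m. \<kappa> X i = s \<longrightarrow> \<kappa> X j = t" for s
  proof (intro exI ballI impI)
    fix X assume X: "X \<in> m" "\<kappa> X i = s"
    let ?Y = "SOME Y. Y \<in> m \<and> \<kappa> Y i = s"
    have Y: "?Y \<in> m \<and> \<kappa> ?Y i = s" by (rule someI[of _ X]) (use X in simp)
    then have "\<kappa> (X - ?Y) j = 0" using X assms subalgebraD(5)[OF m, of X ?Y]
      unfolding coupled_def by (auto simp: \<kappa>_diff)
    then show "\<kappa> X j = \<kappa> ?Y j" using assms(2) by (simp add: \<kappa>_diff)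
  qed
  then obtain \<theta> where \<theta>: "\<And>X. X \<in> m \<Longrightarrow> \<kappa> X j = \<theta> (\<kappa> X i)" by metis
  have ex: "\<exists>X\<in>m. \<kappa> X i = s" "\<exists>X\<in>m. \<kappa> X j = s" for s
    using onto[OF assms(1)] onto[OF assms(2)] by (metis UNIV_I imageE)+
  have "\<theta> \<in> carrier (Aut S)"
  proof (rule S_Aut_surjI)
    fix x y c
    obtain X Y where X: "X \<in> m" "\<kappa> X i = x" and Y: "Y \<in> m" "\<kappa> Y i = y" using ex(1) by metis
    show "\<theta> (x + y) = \<theta> x + \<theta> y"
      using \<theta>[OF subalgebraD(2)[OF m X(1) Y(1)]] \<theta>[OF X(1)] \<theta>[OF Y(1)] X Y assms by (simp add: \<kappa>_add)
    show "\<theta> (brac S x y) = brac S (\<theta> x) (\<theta> y)"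
      using \<theta>[OF subalgebraD(4)[OF m X(1) Y(1)]] \<theta>[OF X(1)] \<theta>[OF Y(1)] X Y assms by (simp add: \<kappa>_brac)
    show "\<theta> (scal S c x) = scal S c (\<theta> x)"
      using \<theta>[OF subalgebraD(3)[OF m X(1), of c]] \<theta>[OF X(1)] X assms by (simp add: \<kappa>_scal)
  next
    show "surj \<theta>" using ex(2) \<theta> by (metis surj_def)
  qed
  with \<theta> show ?thesis by blast
qed

lemma coupled_sym:
  assumes "i \<in> {1..n}" "j \<in> {1..n}" "coupled m i j"
  shows "coupled m j i"
  using coupled_iso[OF assms] S_Aut_zero unfolding coupled_def by metis

text \<open>Elements of \<open>m\<close> vanishing at any set of indices not coupled to \<open>b\<close> still have arbitrary
  \<open>b\<close>-th component: each further index is treated by bracketing with elements that vanish there,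
  which leaves a non-zero ideal of \<open>S\<close>.\<close>

lemma uncoupled_onto:
  assumes "b \<in> {1..n}"
  shows "\<exists>X\<in>m. \<kappa> X b = s \<and> (\<forall>i\<in>{1..n}. \<not> coupled m b i \<longrightarrow> \<kappa> X i = 0)"
proof -
  let ?J = "\<lambda>F. {X \<in> m. \<forall>i\<in>F. \<kappa> X i = 0}"
  have ideal: "lie_ideal S ((\<lambda>X. \<kappa> X b) ` ?J F)" if "F \<subseteq> {1..n}" for F
  proof (rule lie_hom_image_ideal[OF L.lie_algebra_axioms S.lie_algebra_axioms \<kappa>_hom[OF assms] m onto[OF assms]])
    fix c X Y assume Y: "Y \<in> ?J F"
    show "scal L c Y \<in> ?J F" "X \<in> m \<Longrightarrow> brac L X Y \<in> ?J F" "X \<in> ?J F \<Longrightarrow> X + Y \<in> ?J F"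
      using that Y subalgebraD[OF m] by (auto simp: subset_iff \<kappa>_scal \<kappa>_brac \<kappa>_add)
  qed (use that subalgebraD(1)[OF m] in \<open>auto simp: subset_iff \<kappa>_zero\<close>)
  have "(\<lambda>X. \<kappa> X b) ` ?J F = UNIV" if "finite F" "F \<subseteq> {i\<in>{1..n}. \<not> coupled m b i}" for F
    using that
  proof (induction F)
    case empty
    then show ?case using onto[OF assms] by simp
  next
    case (insert i F)
    then have i: "i \<in> {1..n}" "\<not> coupled m i b" using coupled_sym assms by blast+
    then have "(\<lambda>X. \<kappa> X b) ` ?J {i} \<noteq> {0}" unfolding coupled_def by auto
    then have 1: "(\<lambda>X. \<kappa> X b) ` ?J {i} = UNIV"
      using simple ideal[of "{i}"] i unfolding lie_simple_def by blast
    obtain x y where xy: "brac S x y \<noteq> 0" using S_nontrivial by metis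
    obtain X where X: "X \<in> ?J {i}" "\<kappa> X b = x" using 1 by (metis (no_types, lifting) UNIV_I imageE)
    obtain Y where Y: "Y \<in> ?J F" "\<kappa> Y b = y" using insert by (metis (no_types, lifting) UNIV_I imageE insert_subset)
    have "brac L X Y \<in> ?J (insert i F)"
      using X Y subalgebraD(4)[OF m] i insert.prems by (auto simp: \<kappa>_brac subset_iff)
    moreover have "\<kappa> (brac L X Y) b \<noteq> 0" using X Y xy assms by (simp add: \<kappa>_brac)
    ultimately have "(\<lambda>X. \<kappa> X b) ` ?J (insert i F) \<noteq> {0}" by blast
    then show ?case using simple ideal[of "insert i F"] insert.prems unfolding lie_simple_def by blast
  qed
  from this[of "{i\<in>{1..n}. \<not> coupled m b i}"]
  have "s \<in> (\<lambda>X. \<kappa> X b) ` ?J {i\<in>{1..n}. \<not> coupled m b i}" by simp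
  then show ?thesis by blast
qed

text \<open>Membership in \<open>m\<close> can be tested on each class of coupled indices separately.\<close>

lemma subdirect_memI:
  assumes "\<And>i. i \<in> {1..n} \<Longrightarrow> \<exists>Z\<in>m. \<forall>j\<in>{1..n}. coupled m i j \<longrightarrow> \<kappa> X j = \<kappa> Z j"
  shows "X \<in> m"
proof -
  have "\<exists>W\<in>m. \<forall>j\<in>{1..n}. \<kappa> W j = (if \<exists>i\<in>F. coupled m i j then \<kappa> X j else 0)"
    if "finite F" "F \<subseteq> {1..n}" for F
    using that
  proof (induction F)
    case empty
    then show ?case using subalgebraD(1)[OF m] \<kappa>_zero by (intro bexI[of _ 0]) auto
  next
    case (insert c F)
    then obtain W where W: "W \<in> m" "\<And>j. j \<in> {1..n} \<Longrightarrow> \<kappa> W j = (if \<exists>i\<in>F. coupled m i j then \<kappa> X j else 0)"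
      by auto
    have c: "c \<in> {1..n}" using insert by simp
    have sym: "coupled m i j \<longleftrightarrow> coupled m j i" if "i \<in> {1..n}" "j \<in> {1..n}" for i j
      using coupled_sym that by blast
    show ?case
    proof (cases "\<exists>i\<in>F. coupled m i c")
      case True
      then have "(\<exists>i\<in>insert c F. coupled m i j) \<longleftrightarrow> (\<exists>i\<in>F. coupled m i j)" for j
        using coupled_trans by blast
      with W show ?thesis by metis
    next
      case False
      obtain Z where Z: "Z \<in> m" "\<And>j. j \<in> {1..n} \<Longrightarrow> coupled m c j \<Longrightarrow> \<kappa> X j = \<kappa> Z j"
        using assms[OF c] by blast
      obtain V where V: "V \<in> m" "\<kappa> V c = \<kappa> Z c" "\<And>i. i \<in> {1..n} \<Longrightarrow> \<not> coupled m c i \<Longrightarrow> \<kappa> V i = 0"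
        using uncoupled_onto[OF c] by blast
      have VX: "\<kappa> V j = \<kappa> X j" if "j \<in> {1..n}" "coupled m c j" for j
        using coupled_iso[OF c that] V(1,2) Z(1) Z(2)[OF that] by metis
      have "\<kappa> (W + V) j = (if \<exists>i\<in>insert c F. coupled m i j then \<kappa> X j else 0)" if j: "j \<in> {1..n}" for j
      proof (cases "coupled m c j")
        case True
        have "\<not> (\<exists>i\<in>F. coupled m i j)"
          using False True sym[OF c j] coupled_trans by blast
        then show ?thesis using True VX[OF j True] W(2)[OF j] j by (simp add: \<kappa>_add)
      next
        case False
        then show ?thesis using V(3)[OF j False] W(2)[OF j] j by (simp add: \<kappa>_add)
      qed
      then show ?thesis using subalgebraD(2)[OF m W(1) V(1)] by blast
    qed
  qed
  from this[of "{1..n}"] obtain W where W: "W \<in> m"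
    "\<forall>j\<in>{1..n}. \<kappa> W j = (if \<exists>i\<in>{1..n}. coupled m i j then \<kappa> X j else 0)" by auto
  have "W = X" by (rule \<kappa>_eqI) (use W(2) coupled_refl in metis)
  with W(1) show ?thesis by simp
qed

end

end

section \<open>Partitions of an interval into blocks of equal size\<close>

lemma mem_block_iff:
  assumes "0 < p"
  shows "i \<in> block p j \<longleftrightarrow> 1 \<le> i \<and> (i - 1) div p = j"
proof (cases i)
  case (Suc k)
  have "i \<in> block p j \<longleftrightarrow> j * p \<le> k \<and> k < Suc j * p" using Suc by (auto simp: block_def)
  also have "\<dots> \<longleftrightarrow> k div p = j"
    using assms by (metis div_nat_eqI div_less_iff_less_mult div_times_less_eq_dividend
        lessI mult.commute order_refl)
  finally show ?thesis using Suc by simp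
qed (simp add: block_def)

lemma div_less_blocks: "p * q = n \<Longrightarrow> i \<in> {1..n} \<Longrightarrow> (i - 1) div p < (q::nat)"
  by (metis One_nat_def Suc_pred atLeastAtMost_iff less_eq_Suc_le less_mult_imp_div_less mult.commute
      less_le_trans zero_less_one)

lemma block_subset:
  assumes "p * q = n" "b < q"
  shows "block p b \<subseteq> {1..n}"
proof
  fix i assume "i \<in> block p b"
  moreover have "(b + 1) * p \<le> q * p" using assms(2) by (intro mult_right_mono) auto
  ultimately show "i \<in> {1..n}" using assms(1) by (auto simp: block_def mult.commute)
qed

lemma card_block: "card (block p b) = p"
  by (simp add: block_def)

text \<open>An equivalence relation on \<open>{1..n}\<close> with classes of equal size \<open>p\<close> becomes the partition into
  consecutive blocks of length \<open>p\<close> after renumbering.\<close>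

lemma equal_blocks_enumeration:
  fixes R :: "nat \<Rightarrow> nat \<Rightarrow> bool"
  assumes refl: "\<And>i. R i i"
    and sym: "\<And>i j. i \<in> {1..n} \<Longrightarrow> j \<in> {1..n} \<Longrightarrow> R i j \<Longrightarrow> R j i"
    and trans: "\<And>i j k. R i j \<Longrightarrow> R j k \<Longrightarrow> R i k"
    and card: "\<And>i. i \<in> {1..n} \<Longrightarrow> card {j\<in>{1..n}. R i j} = p"
    and "0 < n"
  shows "\<exists>q \<rho>. p * q = n \<and> \<rho> permutes {1..n} \<and>
    (\<forall>i\<in>{1..n}. \<forall>j\<in>{1..n}. R (\<rho> i) (\<rho> j) \<longleftrightarrow> (i - 1) div p = (j - 1) div p)"
proof -
  define c where "c i = {j\<in>{1..n}. R i j}" for i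
  define q where "q = card (c ` {1..n})"
  have c_eq: "c i = c j \<longleftrightarrow> R i j" if "i \<in> {1..n}" "j \<in> {1..n}" for i j
  proof
    assume "c i = c j"
    moreover have "j \<in> c j" using that refl by (simp add: c_def)
    ultimately have "j \<in> c i" by simp
    then show "R i j" by (simp add: c_def)
  next
    assume "R i j"
    then have "R i k \<longleftrightarrow> R j k" for k using sym[OF that] trans by blast
    then show "c i = c j" by (simp add: c_def)
  qed
  have c_mem: "c j = c i" if "i \<in> {1..n}" "j \<in> c i" for i j
    using that c_eq[of j i] sym[of i j] by (simp add: c_def)
  have "p * card (c ` {1..n}) = card (\<Union> (c ` {1..n}))"
  proof (rule card_partition)
    fix A B assume "A \<in> c ` {1..n}" "B \<in> c ` {1..n}" "A \<noteq> B"
    then show "A \<inter> B = {}" using c_mem by blast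
  qed (use card in \<open>auto simp: c_def\<close>)
  moreover have "\<Union> (c ` {1..n}) = {1..n}" using refl by (auto simp: c_def)
  ultimately have pq: "p * q = n" by (simp add: q_def)
  then have p: "0 < p" using \<open>0 < n\<close> by (cases p) auto
  obtain e where e: "bij_betw e {0..<q} (c ` {1..n})"
    using ex_bij_betw_nat_finite[of "c ` {1..n}"] by (auto simp: q_def)
  have "\<exists>f. bij_betw f {0..<p} B" if "B \<in> c ` {1..n}" for B
    using ex_bij_betw_nat_finite[of B] card that by (auto simp: c_def)
  then obtain f where f: "\<And>B. B \<in> c ` {1..n} \<Longrightarrow> bij_betw (f B) {0..<p} B" by metis
  define r where "r k = f (e (k div p)) (k mod p)" for k
  have eB: "e (k div p) \<in> c ` {1..n}" if "k < n" for k
    using bij_betw_apply[OF e, of "k div p"] less_mult_imp_div_less[of k q p] that pq by (simp add: mult.commute)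
  have r_mem: "r k \<in> e (k div p)" if "k < n" for k
    unfolding r_def using bij_betw_apply[OF f[OF eB[OF that]], of "k mod p"] p by simp
  have r_in: "r k \<in> {1..n}" and c_r: "c (r k) = e (k div p)" if "k < n" for k
  proof -
    have "e (k div p) \<in> c ` {1..n}" by (rule eB[OF that])
    then obtain x where x: "x \<in> {1..n}" "e (k div p) = c x" by blast
    then have "r k \<in> c x" using r_mem[OF that] by simp
    then show "r k \<in> {1..n}" "c (r k) = e (k div p)" using c_mem[OF x(1)] x(2) by (auto simp: c_def)
  qed
  have R_r: "R (r k) (r l) \<longleftrightarrow> k div p = l div p" if "k < n" "l < n" for k l
  proof -
    have "R (r k) (r l) \<longleftrightarrow> e (k div p) = e (l div p)"
      using c_eq[OF r_in r_in] c_r that by metis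
    also have "\<dots> \<longleftrightarrow> k div p = l div p"
      using bij_betw_imp_inj_on[OF e] less_mult_imp_div_less[of _ q p] that pq
      by (auto simp: inj_on_eq_iff mult.commute)
    finally show ?thesis .
  qed
  have r_inj: "k = l" if kl: "k < n" "l < n" "r k = r l" for k l
  proof -
    have d: "k div p = l div p" using R_r[OF kl(1,2)] kl(3) refl by simp
    then have "k mod p = l mod p"
      using kl(3) bij_betw_imp_inj_on[OF f[OF eB[OF kl(1)]]] p unfolding r_def by (simp add: inj_on_eq_iff)
    with d show ?thesis by (metis div_mult_mod_eq)
  qed
  define \<rho> where "\<rho> i = (if i \<in> {1..n} then r (i - 1) else i)" for i
  have lt: "i - 1 < n" if "i \<in> {1..n}" for i using that by auto
  have "inj_on \<rho> {1..n}"
  proof (rule inj_onI)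
    fix i j assume ij: "i \<in> {1..n}" "j \<in> {1..n}" "\<rho> i = \<rho> j"
    then have "i - 1 = j - 1" using r_inj[OF lt[OF ij(1)] lt[OF ij(2)]] by (simp add: \<rho>_def)
    then show "i = j" using ij by auto
  qed
  moreover have "\<rho> ` {1..n} \<subseteq> {1..n}" using r_in lt by (auto simp: \<rho>_def image_subset_iff)
  ultimately have "bij_betw \<rho> {1..n} {1..n}"
    unfolding bij_betw_def using endo_inj_surj[of "{1..n}" \<rho>] by simp
  then have "\<rho> permutes {1..n}" by (rule bij_imp_permutes) (auto simp: \<rho>_def)
  moreover have "R (\<rho> i) (\<rho> j) \<longleftrightarrow> (i - 1) div p = (j - 1) div p"
    if "i \<in> {1..n}" "j \<in> {1..n}" for i j
    using R_r[OF lt[OF that(1)] lt[OF that(2)]] that by (simp add: \<rho>_def)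
  ultimately show ?thesis using pq by blast
qed

lemma permutes_same_block:
  assumes "p * q = n" "0 < p" "\<And>B. B \<in> block p ` {..<q} \<Longrightarrow> \<pi> ` B \<in> block p ` {..<q}"
    and "i \<in> {1..n}" "j \<in> {1..n}" "(i - 1) div p = (j - 1) div p"
  shows "(\<pi> i - 1) div p = (\<pi> j - 1) div p"
proof -
  let ?B = "block p ((i - 1) div p)"
  have "i \<in> ?B" "j \<in> ?B" using assms by (auto simp: mem_block_iff)
  moreover obtain b where "\<pi> ` ?B = block p b"
    using assms(3)[of ?B] div_less_blocks[OF assms(1,4)] by blast
  ultimately have "\<pi> i \<in> block p b" "\<pi> j \<in> block p b" by auto
  then show ?thesis by (simp add: mem_block_iff assms(2))
qed

section \<open>Transitivity on the summands\<close>

context lie_power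
begin

text \<open>Transitivity of the action on \<open>{1..n}\<close> through the index permutations of the automorphisms.\<close>

definition transitive :: "('a \<Rightarrow> 'a) set \<Rightarrow> bool" where
  "transitive G \<longleftrightarrow> (\<forall>i\<in>{1..n}. \<forall>j\<in>{1..n}. \<exists>g\<in>G. \<exists>gs \<pi>. aut_components S n \<kappa> g gs \<pi> \<and> \<pi> i = j)"

lemma Inn_comp_components:
  assumes "u \<in> Inn L" "aut_components S n \<kappa> \<phi> \<phi>s \<pi>"
  shows "\<exists>us. aut_components S n \<kappa> (u \<circ> \<phi>) (\<lambda>i. us i \<circ> \<phi>s i) \<pi> \<and> (\<forall>i\<in>{1..n}. us i \<in> Inn S)"
proof -
  obtain us where us: "aut_components S n \<kappa> u us id" "\<forall>i\<in>{1..n}. us i \<in> Inn S"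
    using Inn_components[OF assms(1)] by blast
  from aut_components_comp[OF us(1) assms(2)] us(2) show ?thesis by auto
qed

text \<open>The sum of the summands indexed by an orbit is a \<open>\<Sigma>\<close>-invariant ideal, hence everything.\<close>

lemma Sigma_simple_transitive:
  assumes \<Sigma>: "subgroup \<Sigma> (Out L)" and simp: "Sigma_simple L \<Sigma>"
  shows "transitive (Aut_over L \<Sigma>)"
  unfolding transitive_def
proof (intro ballI)
  fix i j assume i: "i \<in> {1..n}" and j: "j \<in> {1..n}"
  let ?A = "Aut_over L \<Sigma>"
  have A: "subgroup ?A (Aut L)" by (rule L.Aut_over_subgroup[OF \<Sigma>])
  note A' = A[unfolded L.subgroup_Aut_iff]
  define Orb where "Orb = {k. \<exists>\<phi>\<in>?A. \<exists>\<phi>s \<pi>. aut_components S n \<kappa> \<phi> \<phi>s \<pi> \<and> \<pi> i = k}"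
  define I where "I = {X. \<forall>k\<in>{1..n}. k \<notin> Orb \<longrightarrow> \<kappa> X k = 0}"
  have ideal: "lie_ideal L I"
    unfolding L.lie_ideal_iff I_def by (auto simp: \<kappa>_zero \<kappa>_add \<kappa>_scal \<kappa>_brac)
  have sub: "\<phi> ` I \<subseteq> I" if "\<phi> \<in> ?A" for \<phi>
  proof -
    have \<phi>: "\<phi> \<in> carrier (Aut L)" by (rule L.Aut_over_Aut[OF that])
    then obtain \<phi>s \<pi> where c: "aut_components S n \<kappa> \<phi> \<phi>s \<pi>"
      using Aut_components_exist by blast
    note D = aut_componentsD[OF c]
    have "k \<in> Orb" if "\<pi> k \<in> Orb" for k
    proof -
      obtain \<theta> \<theta>s \<rho> where \<theta>: "\<theta> \<in> ?A" "aut_components S n \<kappa> \<theta> \<theta>s \<rho>" "\<rho> i = \<pi> k"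
        using \<open>\<pi> k \<in> Orb\<close> by (auto simp: Orb_def)
      from aut_components_comp[OF \<theta>(2) aut_components_inv[OF \<phi> c]]
      have "aut_components S n \<kappa> (\<theta> \<circ> Hilbert_Choice.inv \<phi>)
        (\<lambda>i. \<theta>s i \<circ> Hilbert_Choice.inv (\<phi>s (Hilbert_Choice.inv \<pi> (\<rho> i)))) (Hilbert_Choice.inv \<pi> \<circ> \<rho>)" .
      moreover have "(Hilbert_Choice.inv \<pi> \<circ> \<rho>) i = k"
        using \<theta>(3) permutes_inverses[OF D(1)] by simp
      moreover have "\<theta> \<circ> Hilbert_Choice.inv \<phi> \<in> ?A" using \<theta>(1) \<open>\<phi> \<in> ?A\<close> A' by blast
      ultimately show ?thesis unfolding Orb_def by blast
    qed
    then have "\<kappa> X (\<pi> k) = 0" if "X \<in> I" "k \<in> {1..n}" "k \<notin> Orb" for X k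
      using that D(4)[OF that(2)] unfolding I_def by blast
    then have "\<kappa> (\<phi> X) k = 0" if "X \<in> I" "k \<in> {1..n}" "k \<notin> Orb" for X k
      using that D(3)[OF that(2), of X] S_Aut_zero[OF D(2)[OF that(2)]] by simp
    then show ?thesis unfolding I_def by blast
  qed
  have "Aut_over_stab L \<Sigma> I = ?A"
    using L.subgroup_image_eqI[OF A sub] by (auto simp: Aut_over_stab_def)
  then have "Sigma_invariant L \<Sigma> I"
    unfolding Sigma_invariant_def using L.out_class_Aut_over[OF \<Sigma>] by simp
  with simp ideal have I: "I = {0} \<or> I = UNIV" unfolding Sigma_simple_def by blast
  obtain s :: 'b where s: "s \<noteq> 0" using S_nontrivial by metis
  have "aut_components S n \<kappa> id (\<lambda>_. id) id" by (simp add: aut_components_def permutes_id S.Aut_id)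
  moreover have "id \<in> ?A" using A' by blast
  ultimately have "i \<in> Orb" unfolding Orb_def by (metis (mono_tags, lifting) id_apply mem_Collect_eq)
  then have "tuple (\<lambda>k. if k = i then s else 0) \<in> I" by (auto simp: I_def)
  moreover have "tuple (\<lambda>k. if k = i then s else 0) \<noteq> 0"
  proof
    assume "tuple (\<lambda>k. if k = i then s else 0) = 0"
    then have "\<kappa> (tuple (\<lambda>k. if k = i then s else 0)) i = 0" using \<kappa>_zero[OF i] by metis
    then show False using s i by simp
  qed
  ultimately have "I = UNIV" using I by blast
  then have "tuple (\<lambda>_. s) \<in> I" by blast
  then have "j \<in> Orb" using s j unfolding I_def by auto
  then show "\<exists>\<phi>\<in>?A. \<exists>\<phi>s \<pi>. aut_components S n \<kappa> \<phi> \<phi>s \<pi> \<and> \<pi> i = j" unfolding Orb_def by blast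
qed

lemma Sigma_invariant_transitive:
  assumes "subgroup \<Sigma> (Out L)" "Sigma_simple L \<Sigma>" "Sigma_invariant L \<Sigma> m"
  shows "transitive (Aut_over_stab L \<Sigma> m)"
  unfolding transitive_def
proof (intro ballI)
  fix i j assume "i \<in> {1..n}" "j \<in> {1..n}"
  then obtain \<phi> \<phi>s \<pi> where \<phi>: "\<phi> \<in> Aut_over L \<Sigma>" "aut_components S n \<kappa> \<phi> \<phi>s \<pi>" "\<pi> i = j"
    using Sigma_simple_transitive[OF assms(1,2)] unfolding transitive_def by blast
  obtain u g where ug: "u \<in> Inn L" "g \<in> Aut_over_stab L \<Sigma> m" "\<phi> = u \<circ> g"
    by (rule L.Sigma_invariant_decomp[OF assms(1,3) \<phi>(1)])
  have "g = Hilbert_Choice.inv u \<circ> \<phi>"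
    unfolding ug(3) using L.Aut_inv_apply(2)[OF L.Inn_Aut[OF ug(1)]] by auto
  then have "\<exists>gs. aut_components S n \<kappa> g gs \<pi>"
    using Inn_comp_components[OF L.Inn_inv[OF ug(1)] \<phi>(2)] by blast
  with ug(2) \<phi>(3) show "\<exists>g\<in>Aut_over_stab L \<Sigma> m. \<exists>gs \<pi>. aut_components S n \<kappa> g gs \<pi> \<and> \<pi> i = j" by blast
qed

section \<open>Subalgebras of simple type\<close>

text \<open>The twist \<open>\<Phi>\<close> acts on the \<open>i\<close>-th summand as the first component of an element of \<open>G\<close> that carries
  this summand to the first one. After the twist these elements have first component \<open>id\<close>.\<close>

lemma product_normal_form:
  assumes "0 < n" and trans: "transitive G" and inv: "\<And>g. g \<in> G \<Longrightarrow> g ` m = m"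
    and G: "subgroup G (Aut L)"
    and prod: "\<And>X. (\<And>i. i \<in> {1..n} \<Longrightarrow> \<kappa> X i \<in> (\<lambda>X. \<kappa> X i) ` m) \<Longrightarrow> X \<in> m"
  obtains \<Phi> ms where "\<Phi> \<in> carrier (Aut L)" "\<Phi> ` m = copies_sum n \<kappa> ms"
    "\<And>i. i \<in> {1..n} \<Longrightarrow> \<exists>g\<in>G. \<exists>hs \<pi>.
       aut_components S n \<kappa> (\<Phi> \<circ> g \<circ> Hilbert_Choice.inv \<Phi>) hs \<pi> \<and> \<pi> 1 = i \<and> hs 1 = id"
proof -
  have one: "1 \<in> {1..n}" using assms(1) by auto
  have id: "id \<in> G" "aut_components S n \<kappa> id (\<lambda>_. id) id"
    using G by (simp_all add: L.subgroup_Aut_iff aut_components_def permutes_id S.Aut_id)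
  have "\<exists>g gs \<pi>. g \<in> G \<and> aut_components S n \<kappa> g gs \<pi> \<and> \<pi> 1 = i \<and> (i = 1 \<longrightarrow> gs 1 = id)"
    if "i \<in> {1..n}" for i
  proof (cases "i = 1")
    case True
    with id show ?thesis by (intro exI[of _ id] exI[of _ "\<lambda>_. id"]) simp
  next
    case False
    with trans one that show ?thesis unfolding transitive_def by blast
  qed
  then obtain g gs \<pi> where g: "\<And>i. i \<in> {1..n} \<Longrightarrow> g i \<in> G \<and> aut_components S n \<kappa> (g i) (gs i) (\<pi> i) \<and>
      \<pi> i 1 = i \<and> (i = 1 \<longrightarrow> gs i 1 = id)" by metis
  define \<psi> where "\<psi> i = gs i 1" for i
  have \<psi>: "\<psi> i \<in> carrier (Aut S)" if "i \<in> {1..n}" for i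
    using g[OF that] aut_componentsD(2) one unfolding \<psi>_def by blast
  obtain \<Phi> where \<Phi>: "\<Phi> \<in> carrier (Aut L)" "aut_components S n \<kappa> \<Phi> \<psi> id"
    using ex_Aut_components[OF permutes_id, of \<psi>] \<psi> by blast
  note \<Phi>D = aut_componentsD[OF \<Phi>(2)]
  define ms where "ms = (\<lambda>X. \<kappa> X 1) ` m"
  have \<psi>_ms: "\<psi> i ` (\<lambda>X. \<kappa> X i) ` m = ms" if i: "i \<in> {1..n}" for i
  proof -
    have "\<psi> i (\<kappa> X i) = \<kappa> (g i X) 1" for X
      using aut_componentsD(3)[of "g i" "gs i" "\<pi> i" 1 X] g[OF i] one by (simp add: \<psi>_def)
    then have "\<psi> i ` (\<lambda>X. \<kappa> X i) ` m = (\<lambda>X. \<kappa> X 1) ` g i ` m" by (simp add: image_image)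
    then show ?thesis using inv[of "g i"] g[OF i] by (simp add: ms_def)
  qed
  have "\<Phi> ` m = copies_sum n \<kappa> ms"
  proof
    have "\<kappa> (\<Phi> X) i \<in> ms" if "X \<in> m" "i \<in> {1..n}" for X i
      using \<Phi>D(3)[OF that(2), of X] \<psi>_ms[OF that(2)] that(1) by auto
    then show "\<Phi> ` m \<subseteq> copies_sum n \<kappa> ms" unfolding copies_sum_def by blast
    show "copies_sum n \<kappa> ms \<subseteq> \<Phi> ` m"
    proof
      fix Y assume Y: "Y \<in> copies_sum n \<kappa> ms"
      let ?X = "Hilbert_Choice.inv \<Phi> Y"
      have "?X \<in> m"
      proof (rule prod)
        fix i assume i: "i \<in> {1..n}"
        have "\<psi> i (\<kappa> ?X i) = \<kappa> Y i"
          using \<Phi>D(3)[OF i, of ?X] L.Aut_inv_apply(1)[OF \<Phi>(1)] by simp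
        then have "\<psi> i (\<kappa> ?X i) \<in> \<psi> i ` (\<lambda>X. \<kappa> X i) ` m"
          using Y i \<psi>_ms[OF i] by (simp add: copies_sum_def)
        moreover have "inj (\<psi> i)" using \<psi>[OF i] by (simp add: carrier_Aut bij_is_inj)
        ultimately show "\<kappa> ?X i \<in> (\<lambda>X. \<kappa> X i) ` m" by (simp only: inj_image_mem_iff)
      qed
      then show "Y \<in> \<Phi> ` m" using L.Aut_inv_apply(1)[OF \<Phi>(1)] by (metis image_eqI)
    qed
  qed
  moreover have "\<exists>g\<in>G. \<exists>hs \<pi>.
       aut_components S n \<kappa> (\<Phi> \<circ> g \<circ> Hilbert_Choice.inv \<Phi>) hs \<pi> \<and> \<pi> 1 = i \<and> hs 1 = id"
    if i: "i \<in> {1..n}" for i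
  proof -
    have gi: "aut_components S n \<kappa> (g i) (gs i) (\<pi> i)" "\<pi> i 1 = i" "g i \<in> G" using g[OF i] by auto
    have \<psi>1: "\<psi> 1 = id" using g[OF one] by (simp add: \<psi>_def)
    note c = aut_components_comp[OF aut_components_comp[OF \<Phi>(2) gi(1)] aut_components_inv[OF \<Phi>]]
    have hs: "\<psi> 1 \<circ> gs i (id 1) \<circ> Hilbert_Choice.inv (\<psi> (Hilbert_Choice.inv id ((\<pi> i \<circ> id) 1))) = id"
      using gi(2) S.Aut_inv_comp(1)[OF \<psi>[OF i]] \<psi>1 by (simp add: \<psi>_def)
    have "(Hilbert_Choice.inv id \<circ> (\<pi> i \<circ> id)) 1 = i" using gi(2) by simp
    with c hs gi(3) show ?thesis by blast
  qed
  ultimately show ?thesis using that \<Phi>(1) by blast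
qed

text \<open>The automorphisms of \<open>S\<close> induced on the \<open>i\<close>-th summand by those elements of \<open>G\<close> that map this
  summand to itself.\<close>

definition induced :: "('a \<Rightarrow> 'a) set \<Rightarrow> nat \<Rightarrow> ('b \<Rightarrow> 'b) set" where
  "induced G i = {gs i | g gs \<pi>. g \<in> G \<and> aut_components S n \<kappa> g gs \<pi> \<and> \<pi> i = i}"

lemma inducedI:
  "aut_components S n \<kappa> g gs \<pi> \<Longrightarrow> g \<in> G \<Longrightarrow> \<pi> i = i \<Longrightarrow> t = gs i \<Longrightarrow> t \<in> induced G i"
  unfolding induced_def by blast

lemma inducedE:
  assumes "t \<in> induced G i"
  obtains g gs \<pi> where "g \<in> G" "aut_components S n \<kappa> g gs \<pi>" "\<pi> i = i" "t = gs i"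
  using assms unfolding induced_def by blast

text \<open>The situation after the twist: the elements given by \<open>link\<close> move any component of an element of
  \<open>G\<close> to the first summand, so that all of them belong to \<open>induced G 1\<close>.\<close>

context
  fixes G ms
  assumes n: "0 < n" and G: "subgroup G (Aut L)"
    and max: "L.maximal_invariant G (copies_sum n \<kappa> ms)"
    and link: "\<And>i. i \<in> {1..n} \<Longrightarrow> \<exists>h\<in>G. \<exists>hs \<pi>. aut_components S n \<kappa> h hs \<pi> \<and> \<pi> 1 = i \<and> hs 1 = id"
begin

lemma one_in: "1 \<in> {1..n}"
  using n by auto

lemma G_closed: "g \<in> G \<Longrightarrow> h \<in> G \<Longrightarrow> g \<circ> h \<in> G" "g \<in> G \<Longrightarrow> Hilbert_Choice.inv g \<in> G"
  "g \<in> G \<Longrightarrow> g \<in> carrier (Aut L)" "id \<in> G"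
  using G by (auto simp: L.subgroup_Aut_iff)

text \<open>If \<open>h\<close> and \<open>k\<close> link the first summand to the summands \<open>i\<close> and \<open>\<pi> i\<close>, then \<open>h \<circ> g \<circ> inv k\<close> fixes
  the index \<open>1\<close> and has \<open>gs i\<close> as its first component.\<close>

lemma component_in_induced:
  assumes g: "g \<in> G" "aut_components S n \<kappa> g gs \<pi>" and i: "i \<in> {1..n}"
  shows "gs i \<in> induced G 1"
proof -
  obtain h hs \<rho> where h: "h \<in> G" "aut_components S n \<kappa> h hs \<rho>" "\<rho> 1 = i" "hs 1 = id"
    using link[OF i] by blast
  obtain k ks \<tau> where k: "k \<in> G" "aut_components S n \<kappa> k ks \<tau>" "\<tau> 1 = \<pi> i" "ks 1 = id"
    using link[OF aut_componentsD(4)[OF g(2) i]] by blast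
  have \<tau>: "Hilbert_Choice.inv \<tau> (\<pi> i) = 1"
    using permutes_inverses(2)[OF aut_componentsD(1)[OF k(2)], of 1] k(3) by simp
  note c = aut_components_comp[OF aut_components_comp[OF h(2) g(2)] aut_components_inv[OF G_closed(3)[OF k(1)] k(2)]]
  have "h \<circ> g \<circ> Hilbert_Choice.inv k \<in> G" by (intro G_closed(1,2) g(1) h(1) k(1))
  moreover have "gs i = hs 1 \<circ> gs (\<rho> 1) \<circ> Hilbert_Choice.inv (ks (Hilbert_Choice.inv \<tau> ((\<pi> \<circ> \<rho>) 1)))"
    by (simp add: \<tau> h(3,4) k(4) del: One_nat_def)
  moreover have "(Hilbert_Choice.inv \<tau> \<circ> (\<pi> \<circ> \<rho>)) 1 = 1" using h(3) by (simp add: \<tau>)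
  ultimately show ?thesis by (intro inducedI[OF c])
qed

lemma induced_eq:
  assumes i: "i \<in> {1..n}"
  shows "induced G i = induced G 1"
proof
  show "induced G i \<subseteq> induced G 1" using component_in_induced[OF _ _ i] by (blast elim: inducedE)
  show "induced G 1 \<subseteq> induced G i"
  proof
    fix t assume "t \<in> induced G 1"
    then obtain g gs \<pi> where g: "g \<in> G" "aut_components S n \<kappa> g gs \<pi>" "\<pi> 1 = 1" "t = gs 1"
      by (rule inducedE)
    obtain h hs \<rho> where h: "h \<in> G" "aut_components S n \<kappa> h hs \<rho>" "\<rho> 1 = i" "hs 1 = id"
      using link[OF i] by blast
    have \<rho>: "Hilbert_Choice.inv \<rho> i = 1"
      using permutes_inverses(2)[OF aut_componentsD(1)[OF h(2)], of 1] h(3) by simp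
    note c = aut_components_comp[OF aut_components_comp[OF aut_components_inv[OF G_closed(3)[OF h(1)] h(2)] g(2)] h(2)]
    have "Hilbert_Choice.inv h \<circ> g \<circ> h \<in> G" by (intro G_closed(1,2) g(1) h(1))
    moreover have "t = Hilbert_Choice.inv (hs (Hilbert_Choice.inv \<rho> i)) \<circ> gs (Hilbert_Choice.inv \<rho> i) \<circ>
        hs ((\<pi> \<circ> Hilbert_Choice.inv \<rho>) i)"
      by (simp add: \<rho> h(4) g(3,4) del: One_nat_def)
    moreover have "(\<rho> \<circ> (\<pi> \<circ> Hilbert_Choice.inv \<rho>)) i = i" using h(3) g(3) by (simp add: \<rho>)
    ultimately show "t \<in> induced G i" by (intro inducedI[OF c])
  qed
qed

lemma induced_subgroup: "subgroup (induced G 1) (Aut S)"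
  unfolding S.subgroup_Aut_iff
proof (intro conjI ballI subsetI)
  show "t \<in> carrier (Aut S)" if "t \<in> induced G 1" for t
    using that aut_componentsD(2) one_in by (blast elim: inducedE)
  have "aut_components S n \<kappa> id (\<lambda>_. id) id" by (simp add: aut_components_def permutes_id S.Aut_id)
  then show "id \<in> induced G 1" using component_in_induced[OF G_closed(4) _ one_in] by blast
  fix t assume "t \<in> induced G 1"
  then obtain g gs \<pi> where g: "g \<in> G" "aut_components S n \<kappa> g gs \<pi>" "\<pi> 1 = 1" "t = gs 1"
    by (rule inducedE)
  have "Hilbert_Choice.inv \<pi> 1 = 1"
    using permutes_inverses(2)[OF aut_componentsD(1)[OF g(2)], of 1] g(3) by simp
  then show "Hilbert_Choice.inv t \<in> induced G 1"
    using component_in_induced[OF G_closed(2)[OF g(1)] aut_components_inv[OF G_closed(3)[OF g(1)] g(2)] one_in] g(4)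
    by simp
  fix t' assume "t' \<in> induced G 1"
  then obtain h hs \<rho> where h: "h \<in> G" "aut_components S n \<kappa> h hs \<rho>" "\<rho> 1 = 1" "t' = hs 1"
    by (rule inducedE)
  show "t \<circ> t' \<in> induced G 1"
    using component_in_induced[OF G_closed(1)[OF g(1) h(1)] aut_components_comp[OF g(2) h(2)] one_in] g(3,4) h(4)
    by simp
qed

lemma induced_maximal_invariant: "S.maximal_invariant (induced G 1) ms"
  unfolding S.maximal_invariant_def
proof (intro conjI ballI allI impI)
  let ?M = "copies_sum n \<kappa>"
  note M = L.maximal_invariantD[OF max]
  note sub = subalgebraD[OF M(1)]
  have mem: "tuple (\<lambda>_. x) \<in> ?M T \<longleftrightarrow> x \<in> T" for x T
    using one_in by (auto simp: copies_sum_def)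
  have proj: "\<kappa> X 1 \<in> T" if "X \<in> ?M T" for X T using that one_in by (auto simp: copies_sum_def)
  show "lie_subalgebra S ms"
    unfolding S.lie_subalgebra_iff
  proof (intro conjI ballI allI)
    show "0 \<in> ms" using proj[OF sub(1)] one_in by (simp add: \<kappa>_zero)
    fix x c assume "x \<in> ms"
    then have x: "tuple (\<lambda>_. x) \<in> ?M ms" by (simp add: mem)
    show "scal S c x \<in> ms" using proj[OF sub(3)[OF x, of c]] one_in by (simp add: \<kappa>_scal)
    fix y assume "y \<in> ms"
    then have y: "tuple (\<lambda>_. y) \<in> ?M ms" by (simp add: mem)
    show "x + y \<in> ms" using proj[OF sub(2)[OF x y]] one_in by (simp add: \<kappa>_add)
    show "brac S x y \<in> ms" using proj[OF sub(4)[OF x y]] one_in by (simp add: \<kappa>_brac)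
  qed
  show "ms \<noteq> UNIV" using M(2) by (auto simp: copies_sum_def)
  show "t ` ms = ms" if "t \<in> induced G 1" for t
  proof (rule S.subgroup_image_eqI[OF induced_subgroup _ that])
    fix t assume "t \<in> induced G 1"
    then obtain g gs \<pi> where g: "g \<in> G" "aut_components S n \<kappa> g gs \<pi>" "\<pi> 1 = 1" "t = gs 1"
      by (rule inducedE)
    have "t x \<in> ms" if "x \<in> ms" for x
    proof -
      have "g (tuple (\<lambda>_. x)) \<in> ?M ms" using M(3)[OF g(1)] that mem by blast
      then show ?thesis
        using proj aut_componentsD(3)[OF g(2) one_in, of "tuple (\<lambda>_. x)"] g(3,4) one_in by fastforce
    qed
    then show "t ` ms \<subseteq> ms" by blast
  qed
  fix m' assume m': "lie_subalgebra S m' \<and> (\<forall>t\<in>induced G 1. t ` m' = m') \<and> ms \<subseteq> m'"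
  have "?M m' = ?M ms \<or> ?M m' = UNIV"
  proof (rule M(4))
    show "lie_subalgebra L (?M m')"
      using m' unfolding L.lie_subalgebra_iff S.lie_subalgebra_iff copies_sum_def
      by (auto simp: \<kappa>_zero \<kappa>_add \<kappa>_scal \<kappa>_brac)
    show "?M ms \<subseteq> ?M m'" using m' by (auto simp: copies_sum_def)
    fix g assume "g \<in> G"
    then show "g ` ?M m' = ?M m'"
    proof (rule L.subgroup_image_eqI[OF G, rotated])
      fix g assume g: "g \<in> G"
      then obtain gs \<pi> where c: "aut_components S n \<kappa> g gs \<pi>"
        using Aut_components_exist G_closed(3) by blast
      have "\<kappa> (g X) i \<in> m'" if "X \<in> ?M m'" "i \<in> {1..n}" for X i
      proof -
        have "gs i ` m' = m'" using m' component_in_induced[OF g c that(2)] by blast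
        moreover have "\<kappa> X (\<pi> i) \<in> m'" using that aut_componentsD(4)[OF c] by (auto simp: copies_sum_def)
        ultimately show ?thesis using aut_componentsD(3)[OF c that(2), of X] by auto
      qed
      then show "g ` ?M m' \<subseteq> ?M m'" by (auto simp: copies_sum_def)
    qed
  qed
  then show "m' = ms \<or> m' = UNIV" using mem by blast
qed

end

section \<open>Subalgebras of diagonal type\<close>

lemma diag_sum_iff:
  assumes "p * q = n" "0 < p"
  shows "X \<in> diag_sum p q \<kappa> \<longleftrightarrow>
    (\<forall>i\<in>{1..n}. \<forall>j\<in>{1..n}. (i - 1) div p = (j - 1) div p \<longrightarrow> \<kappa> X i = \<kappa> X j)"
proof
  assume "X \<in> diag_sum p q \<kappa>"
  then obtain Y where Y: "\<And>b i. b < q \<Longrightarrow> i \<in> block p b \<Longrightarrow> \<kappa> X i = Y b" by (auto simp: diag_sum_def)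
  have "\<kappa> X i = Y ((i - 1) div p)" if "i \<in> {1..n}" for i
    using Y[OF div_less_blocks[OF assms(1) that], of i] that by (simp add: mem_block_iff assms(2))
  then show "\<forall>i\<in>{1..n}. \<forall>j\<in>{1..n}. (i - 1) div p = (j - 1) div p \<longrightarrow> \<kappa> X i = \<kappa> X j" by simp
next
  assume X: "\<forall>i\<in>{1..n}. \<forall>j\<in>{1..n}. (i - 1) div p = (j - 1) div p \<longrightarrow> \<kappa> X i = \<kappa> X j"
  have "\<kappa> X i = \<kappa> X (b * p + 1)" if "b < q" "i \<in> block p b" for b i
  proof -
    have "b * p + 1 \<in> block p b" using assms(2) by (simp add: block_def)
    then show ?thesis
      using X that block_subset[OF assms(1) that(1)] by (metis mem_block_iff assms(2) subsetD)
  qed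
  then show "X \<in> diag_sum p q \<kappa>" unfolding diag_sum_def
    by (intro CollectI exI[of _ "\<lambda>b. \<kappa> X (b * p + 1)"]) blast
qed

text \<open>The relation of being coupled is invariant under \<open>G\<close>, so its classes have equal size \<open>p\<close> and a
  permutation \<open>\<rho>\<close> makes them consecutive. The twist expresses every component through the first one
  of its block.\<close>

lemma diagonal_normal_form:
  assumes "0 < n" and trans: "transitive G" and inv: "\<And>g. g \<in> G \<Longrightarrow> g ` m = m"
    and m: "lie_subalgebra L m" "m \<noteq> UNIV"
    and onto: "\<And>i. i \<in> {1..n} \<Longrightarrow> (\<lambda>X. \<kappa> X i) ` m = UNIV"
  obtains \<Phi> p q where "\<Phi> \<in> carrier (Aut L)" "p * q = n" "1 < p" "\<Phi> ` m = diag_sum p q \<kappa>"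
proof -
  let ?c = "\<lambda>i. {j\<in>{1..n}. coupled m i j}"
  note iso = coupled_iso[OF m(1) onto]
  have one: "1 \<in> {1..n}" using assms(1) by auto
  have card_le: "card (?c i) \<le> card (?c j)" if ij: "i \<in> {1..n}" "j \<in> {1..n}" for i j
  proof -
    obtain g gs \<pi> where g: "g \<in> G" "aut_components S n \<kappa> g gs \<pi>" "\<pi> i = j"
      using trans ij unfolding transitive_def by blast
    note D = aut_componentsD[OF g(2)]
    have "coupled m j (\<pi> l)" if l: "l \<in> {1..n}" "coupled m i l" for l
      unfolding coupled_def
    proof (intro ballI impI)
      fix Y assume Y: "Y \<in> m" "\<kappa> Y j = 0"
      then have "\<kappa> (g Y) i = 0" using D(3)[OF ij(1), of Y] g(3) S_Aut_zero[OF D(2)[OF ij(1)]] by simp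
      moreover have "g Y \<in> m" using inv[OF g(1)] Y by blast
      ultimately have "\<kappa> (g Y) l = 0" using l(2) unfolding coupled_def by blast
      then show "\<kappa> Y (\<pi> l) = 0" using D(3)[OF l(1), of Y] S_Aut_zero[OF D(2)[OF l(1)]] by simp
    qed
    then have "\<pi> ` ?c i \<subseteq> ?c j" using D(4) by auto
    moreover have "inj_on \<pi> (?c i)" using permutes_inj_on[OF D(1)] .
    ultimately show ?thesis by (intro card_inj_on_le[of \<pi>]) auto
  qed
  define p where "p = card (?c 1)"
  have "\<exists>q \<rho>. p * q = n \<and> \<rho> permutes {1..n} \<and>
    (\<forall>i\<in>{1..n}. \<forall>j\<in>{1..n}. coupled m (\<rho> i) (\<rho> j) \<longleftrightarrow> (i - 1) div p = (j - 1) div p)"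
  proof (rule equal_blocks_enumeration)
    show "card (?c i) = p" if "i \<in> {1..n}" for i
      unfolding p_def using card_le[OF that one] card_le[OF one that] by simp
    show "coupled m j i" if "i \<in> {1..n}" "j \<in> {1..n}" "coupled m i j" for i j
      using coupled_sym[OF m(1) onto] that by blast
  qed (use coupled_refl coupled_trans assms(1) in blast)+
  then obtain q \<rho> where pq: "p * q = n" and \<rho>: "\<rho> permutes {1..n}"
    and \<rho>_iff: "\<And>i j. i \<in> {1..n} \<Longrightarrow> j \<in> {1..n} \<Longrightarrow>
        coupled m (\<rho> i) (\<rho> j) \<longleftrightarrow> (i - 1) div p = (j - 1) div p" by blast
  have p: "0 < p" using pq assms(1) by (cases p) auto
  have \<rho>_in: "\<rho> i \<in> {1..n}" if "i \<in> {1..n}" for i using permD[OF \<rho>] that by blast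
  \<comment> \<open>the first index of the block of \<open>i\<close>\<close>
  define first where "first i = (i - 1) div p * p + 1" for i
  have first: "first i \<in> {1..n}" "(first i - 1) div p = (i - 1) div p" if "i \<in> {1..n}" for i
  proof -
    have "first i \<in> block p ((i - 1) div p)" using p by (simp add: block_def first_def)
    then show "first i \<in> {1..n}" "(first i - 1) div p = (i - 1) div p"
      using block_subset[OF pq div_less_blocks[OF pq that]] by (auto simp: mem_block_iff p)
  qed
  have "\<exists>\<theta>\<in>carrier (Aut S). \<forall>X\<in>m. \<kappa> X (\<rho> (first i)) = \<theta> (\<kappa> X (\<rho> i))" if i: "i \<in> {1..n}" for i
    using iso[of "\<rho> i" "\<rho> (first i)"] \<rho>_in first[OF i] i \<rho>_iff[OF i first(1)[OF i]] by simp
  then obtain \<psi> where \<psi>: "\<And>i. i \<in> {1..n} \<Longrightarrow> \<psi> i \<in> carrier (Aut S)"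
    "\<And>i X. i \<in> {1..n} \<Longrightarrow> X \<in> m \<Longrightarrow> \<kappa> X (\<rho> (first i)) = \<psi> i (\<kappa> X (\<rho> i))" by metis
  obtain \<Phi> where \<Phi>: "\<Phi> \<in> carrier (Aut L)" "aut_components S n \<kappa> \<Phi> \<psi> \<rho>"
    using ex_Aut_components[OF \<rho>, of \<psi>] \<psi>(1) by blast
  note D = aut_componentsD[OF \<Phi>(2)]
  have eq: "\<Phi> ` m = diag_sum p q \<kappa>"
  proof
    have "\<kappa> (\<Phi> X) i = \<kappa> X (\<rho> (first i))" if "X \<in> m" "i \<in> {1..n}" for X i
      using D(3)[OF that(2), of X] \<psi>(2)[OF that(2,1)] by simp
    then show "\<Phi> ` m \<subseteq> diag_sum p q \<kappa>"
      by (auto simp: diag_sum_iff[OF pq p] first_def)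
    show "diag_sum p q \<kappa> \<subseteq> \<Phi> ` m"
    proof
      fix Y assume Y: "Y \<in> diag_sum p q \<kappa>"
      let ?X = "Hilbert_Choice.inv \<Phi> Y"
      have \<psi>X: "\<psi> i (\<kappa> ?X (\<rho> i)) = \<kappa> Y i" if "i \<in> {1..n}" for i
        using D(3)[OF that, of ?X] L.Aut_inv_apply(1)[OF \<Phi>(1)] by simp
      have "?X \<in> m"
      proof (rule subdirect_memI[OF m(1) onto])
        fix k assume k: "k \<in> {1..n}"
        obtain i where i: "i \<in> {1..n}" "\<rho> i = k"
          using k permutes_image[OF \<rho>] by (metis imageE)
        obtain Z where Z: "Z \<in> m" "\<kappa> Z k = \<kappa> ?X k" using onto[OF k] by (metis UNIV_I imageE)
        have "\<kappa> ?X l = \<kappa> Z l" if l: "l \<in> {1..n}" "coupled m k l" for l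
        proof -
          obtain j where j: "j \<in> {1..n}" "\<rho> j = l"
            using l(1) permutes_image[OF \<rho>] by (metis imageE)
          have ij: "(i - 1) div p = (j - 1) div p" using \<rho>_iff[OF i(1) j(1)] l(2) i j by simp
          have "\<kappa> Y i = \<kappa> Y j" using Y[unfolded diag_sum_iff[OF pq p]] i(1) j(1) ij by blast
          then have "\<psi> j (\<kappa> ?X l) = \<kappa> Y i" using \<psi>X[OF j(1)] j(2) by simp
          also have "\<dots> = \<psi> i (\<kappa> Z k)" using \<psi>X[OF i(1)] i(2) Z(2) by simp
          also have "\<dots> = \<psi> j (\<kappa> Z l)"
            unfolding i(2)[symmetric] j(2)[symmetric] \<psi>(2)[OF i(1) Z(1), symmetric]
              \<psi>(2)[OF j(1) Z(1), symmetric] first_def ij ..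
          finally show ?thesis using \<psi>(1)[OF j(1)] by (simp add: carrier_Aut bij_is_inj inj_eq)
        qed
        with Z(1) show "\<exists>Z\<in>m. \<forall>j\<in>{1..n}. coupled m k j \<longrightarrow> \<kappa> ?X j = \<kappa> Z j" by blast
      qed
      then show "Y \<in> \<Phi> ` m" using L.Aut_inv_apply(1)[OF \<Phi>(1)] by (metis image_eqI)
    qed
  qed
  have "p \<noteq> 1"
  proof
    assume "p = 1"
    then have "i = j" if "i \<in> {1..n}" "j \<in> {1..n}" "(i - 1) div p = (j - 1) div p" for i j
      using that by auto
    then have "X \<in> diag_sum p q \<kappa>" for X unfolding diag_sum_iff[OF pq p] by metis
    then have "diag_sum p q \<kappa> = UNIV" by blast
    then have "\<Phi> ` m = UNIV" using eq by simp
    then have "m = UNIV" using \<Phi>(1) by (metis L.Aut_inv_apply(2) UNIV_I UNIV_eq_I imageE)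
    with m(2) show False ..
  qed
  then show ?thesis using that[OF \<Phi>(1) pq _ eq] p by linarith
qed

text \<open>An automorphism preserving the standard diagonal subalgebra has equal components inside a block,
  seen on constant tuples, and its permutation maps blocks into blocks, seen on the indicator of a
  block.\<close>

lemma diag_sum_same_block:
  assumes "p * q = n" "0 < p" "g ` diag_sum p q \<kappa> = diag_sum p q \<kappa>" "aut_components S n \<kappa> g gs \<pi>"
    and ij: "i \<in> {1..n}" "j \<in> {1..n}" "(i - 1) div p = (j - 1) div p"
  shows "(\<pi> i - 1) div p = (\<pi> j - 1) div p" "gs i = gs j"
proof -
  note D = aut_componentsD[OF assms(4)]
  have eq: "gs i (\<kappa> X (\<pi> i)) = gs j (\<kappa> X (\<pi> j))" if "X \<in> diag_sum p q \<kappa>" for X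
  proof -
    have "g X \<in> diag_sum p q \<kappa>" using assms(3) that by blast
    then show ?thesis using ij D(3)[of _ X] by (metis diag_sum_iff[OF assms(1,2)])
  qed
  show "gs i = gs j"
  proof
    fix x
    have "tuple (\<lambda>_. x) \<in> diag_sum p q \<kappa>" by (simp add: diag_sum_iff[OF assms(1,2)])
    from eq[OF this] show "gs i x = gs j x" using D(4) ij by simp
  qed
  obtain s :: 'b where s: "s \<noteq> 0" using S_nontrivial by metis
  let ?X = "tuple (\<lambda>k. if (k - 1) div p = (\<pi> i - 1) div p then s else 0)"
  have "?X \<in> diag_sum p q \<kappa>" by (simp add: diag_sum_iff[OF assms(1,2)])
  from eq[OF this] have "gs i (\<kappa> ?X (\<pi> i)) = gs i (\<kappa> ?X (\<pi> j))" using \<open>gs i = gs j\<close> by simp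
  moreover have "inj (gs i)" using D(2)[OF ij(1)] by (simp add: carrier_Aut bij_is_inj)
  ultimately have "\<kappa> ?X (\<pi> i) = \<kappa> ?X (\<pi> j)" by (simp add: inj_eq)
  then show "(\<pi> i - 1) div p = (\<pi> j - 1) div p" using s D(4) ij by (auto split: if_splits)
qed

lemma diag_sum_block_image:
  assumes "p * q = n" "0 < p" "g ` diag_sum p q \<kappa> = diag_sum p q \<kappa>" "aut_components S n \<kappa> g gs \<pi>"
    and B: "B \<in> block p ` {..<q}"
  shows "\<pi> ` B \<in> block p ` {..<q}"
proof -
  obtain b where b: "b < q" "B = block p b" using B by blast
  let ?i = "b * p + 1"
  have i: "?i \<in> B" using b(2) assms(2) by (simp add: block_def)
  have Bn: "B \<subseteq> {1..n}" using block_subset[OF assms(1) b(1)] b(2) by simp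
  let ?B' = "block p ((\<pi> ?i - 1) div p)"
  have "\<pi> k \<in> ?B'" if "k \<in> B" for k
    using diag_sum_same_block(1)[OF assms(1-4), of k ?i] that i Bn b(2) aut_componentsD(4)[OF assms(4), of k]
    by (auto simp: mem_block_iff[OF assms(2)] subset_iff)
  then have "\<pi> ` B \<subseteq> ?B'" by blast
  moreover have "card (\<pi> ` B) = card ?B'"
    using card_image[OF permutes_inj_on[OF aut_componentsD(1)[OF assms(4)]], of B] b(2) by (simp add: card_block)
  moreover have "finite ?B'" by (simp add: block_def)
  ultimately have "\<pi> ` B = ?B'" by (intro card_subset_eq)
  moreover have "(\<pi> ?i - 1) div p < q"
    using div_less_blocks[OF assms(1)] aut_componentsD(4)[OF assms(4)] i Bn by blast
  ultimately show ?thesis by blast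
qed

lemma equalizer_subalgebra:
  "lie_subalgebra L {X. \<forall>i\<in>{1..n}. \<forall>j\<in>{1..n}. r i j \<longrightarrow> \<kappa> X i = \<kappa> X j}"
  unfolding L.lie_subalgebra_iff mem_Collect_eq
proof (intro conjI ballI allI impI)
  fix X c i j
  assume X: "X \<in> {X. \<forall>i\<in>{1..n}. \<forall>j\<in>{1..n}. r i j \<longrightarrow> \<kappa> X i = \<kappa> X j}"
    and ij: "i \<in> {1..n}" "j \<in> {1..n}" "r i j"
  from X ij have 1: "\<kappa> X i = \<kappa> X j" by blast
  with ij show "\<kappa> (scal L c X) i = \<kappa> (scal L c X) j" by (simp add: \<kappa>_scal)
  fix Y assume "Y \<in> {X. \<forall>i\<in>{1..n}. \<forall>j\<in>{1..n}. r i j \<longrightarrow> \<kappa> X i = \<kappa> X j}"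
  with ij have "\<kappa> Y i = \<kappa> Y j" by blast
  with 1 ij show "\<kappa> (X + Y) i = \<kappa> (X + Y) j" "\<kappa> (brac L X Y) i = \<kappa> (brac L X Y) j"
    by (simp_all add: \<kappa>_add \<kappa>_brac)
qed (simp add: \<kappa>_zero)

text \<open>The subalgebra \<open>D\<close> of elements that are constant on the intersections of \<open>p\<close>-blocks with
  \<open>p'\<close>-blocks is invariant and contains the diagonal one. It is proper because \<open>1\<close> and \<open>2\<close> lie in
  a common intersection, and strictly larger if \<open>p' < p\<close> because \<open>1\<close> and \<open>p' + 1\<close> are separated.\<close>

lemma diag_sum_block_minimal:
  assumes pq: "p * q = n" and p: "1 < p" and n: "0 < n" and G: "subgroup G (Aut L)"
    and max: "L.maximal_invariant G (diag_sum p q \<kappa>)"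
    and pq': "p' * q' = n" and p': "1 < p'"
    and blocks: "\<And>g gs \<pi> B. g \<in> G \<Longrightarrow> aut_components S n \<kappa> g gs \<pi> \<Longrightarrow>
        B \<in> block p' ` {..<q'} \<Longrightarrow> \<pi> ` B \<in> block p' ` {..<q'}"
  shows "p \<le> p'"
proof (rule ccontr)
  assume lt: "\<not> p \<le> p'"
  have p0: "0 < p" "0 < p'" using p p' by auto
  note M = L.maximal_invariantD[OF max]
  let ?r = "\<lambda>i j. (i - 1) div p = (j - 1) div p \<and> (i - 1) div p' = (j - 1) div p'"
  define D where "D = {X. \<forall>i\<in>{1..n}. \<forall>j\<in>{1..n}. ?r i j \<longrightarrow> \<kappa> X i = \<kappa> X j}"
  have "D = diag_sum p q \<kappa> \<or> D = UNIV"
  proof (rule M(4))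
    show "lie_subalgebra L D" unfolding D_def by (rule equalizer_subalgebra)
    show "diag_sum p q \<kappa> \<subseteq> D"
      unfolding D_def subset_iff mem_Collect_eq diag_sum_iff[OF pq p0(1)] by blast
    fix g assume "g \<in> G"
    then show "g ` D = D"
    proof (rule L.subgroup_image_eqI[OF G, rotated])
      fix g assume g: "g \<in> G"
      then have "g \<in> carrier (Aut L)" using G by (auto simp: L.subgroup_Aut_iff)
      then obtain gs \<pi> where c: "aut_components S n \<kappa> g gs \<pi>"
        using Aut_components_exist by blast
      note C = aut_componentsD[OF c]
      have "\<kappa> (g X) i = \<kappa> (g X) j" if X: "X \<in> D" and ij: "i \<in> {1..n}" "j \<in> {1..n}" "?r i j" for X i j
      proof -
        have "?r (\<pi> i) (\<pi> j)" "gs i = gs j"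
          using diag_sum_same_block[OF pq p0(1) M(3)[OF g] c ij(1,2)] ij(3)
            permutes_same_block[OF pq' p0(2) blocks[OF g c] ij(1,2)] by blast+
        moreover have "\<kappa> X (\<pi> i) = \<kappa> X (\<pi> j)"
          using X C(4) ij(1,2) \<open>?r (\<pi> i) (\<pi> j)\<close> unfolding D_def by blast
        ultimately show ?thesis using C(3)[OF ij(1), of X] C(3)[OF ij(2), of X] by simp
      qed
      then show "g ` D \<subseteq> D" unfolding D_def by blast
    qed
  qed
  moreover have "D \<noteq> UNIV"
  proof
    assume "D = UNIV"
    obtain s :: 'b where s: "s \<noteq> 0" using S_nontrivial by metis
    have "q \<ge> 1" using pq n by (cases q) auto
    then have "p \<le> n" using pq by (metis mult.right_neutral mult_le_mono2)
    then have 12: "1 \<in> {1..n}" "2 \<in> {1..n}" using p by auto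
    have "?r 1 2" using p p' by simp
    have "tuple (\<lambda>k. if k = 1 then s else 0) \<in> D" using \<open>D = UNIV\<close> by blast
    then have "\<kappa> (tuple (\<lambda>k. if k = 1 then s else 0)) 1 = \<kappa> (tuple (\<lambda>k. if k = 1 then s else 0)) 2"
      unfolding D_def using 12 \<open>?r 1 2\<close> by blast
    then show False using s 12 by simp
  qed
  moreover have "D \<noteq> diag_sum p q \<kappa>"
  proof
    assume D: "D = diag_sum p q \<kappa>"
    obtain s :: 'b where s: "s \<noteq> 0" using S_nontrivial by metis
    have "q \<ge> 1" using pq n by (cases q) auto
    then have "p \<le> n" using pq by (metis mult.right_neutral mult_le_mono2)
    then have 12: "1 \<in> {1..n}" "p' + 1 \<in> {1..n}" using lt n by auto
    let ?X = "tuple (\<lambda>k. if (k - 1) div p' = 0 then s else 0)"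
    have "(1 - 1) div p = (p' + 1 - 1) div p" using lt by simp
    have "?X \<in> D" by (simp add: D_def)
    then have "\<kappa> ?X 1 = \<kappa> ?X (p' + 1)"
      using 12 \<open>(1 - 1) div p = (p' + 1 - 1) div p\<close> unfolding D diag_sum_iff[OF pq p0(1)] by blast
    then show False using s 12 p0 by simp
  qed
  ultimately show False by blast
qed

end

section \<open>The two types of primitive subalgebras\<close>

context lie_power
begin

text \<open>The sum of the projections of \<open>m\<close> to all summands, to which primitivity is applied.\<close>

lemma projections_subalgebra:
  assumes m: "lie_subalgebra L m"
  shows "lie_subalgebra L {X. \<forall>i\<in>{1..n}. \<kappa> X i \<in> (\<lambda>X. \<kappa> X i) ` m}"
  unfolding L.lie_subalgebra_iff mem_Collect_eq
proof (intro conjI ballI allI)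
  note sub = subalgebraD[OF m]
  fix i assume i: "i \<in> {1..n}"
  show "\<kappa> 0 i \<in> (\<lambda>X. \<kappa> X i) ` m" using sub(1) by blast
  fix X c assume "X \<in> {X. \<forall>i\<in>{1..n}. \<kappa> X i \<in> (\<lambda>X. \<kappa> X i) ` m}"
  then obtain X' where X: "X' \<in> m" "\<kappa> X i = \<kappa> X' i" using i by blast
  show "\<kappa> (scal L c X) i \<in> (\<lambda>X. \<kappa> X i) ` m"
    using sub(3)[OF X(1), of c] X(2) i by (intro image_eqI[of _ _ "scal L c X'"]) (simp_all add: \<kappa>_scal)
  fix Y assume "Y \<in> {X. \<forall>i\<in>{1..n}. \<kappa> X i \<in> (\<lambda>X. \<kappa> X i) ` m}"
  then obtain Y' where Y: "Y' \<in> m" "\<kappa> Y i = \<kappa> Y' i" using i by blast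
  show "\<kappa> (X + Y) i \<in> (\<lambda>X. \<kappa> X i) ` m"
    using sub(2)[OF X(1) Y(1)] X(2) Y(2) i by (intro image_eqI[of _ _ "X' + Y'"]) (simp_all add: \<kappa>_add)
  show "\<kappa> (brac L X Y) i \<in> (\<lambda>X. \<kappa> X i) ` m"
    using sub(4)[OF X(1) Y(1)] X(2) Y(2) i by (intro image_eqI[of _ _ "brac L X' Y'"]) (simp_all add: \<kappa>_brac)
qed

lemma projections_invariant:
  assumes G: "subgroup G (Aut L)" and inv: "\<And>g. g \<in> G \<Longrightarrow> g ` m = m" and "g \<in> G"
  shows "g ` {X. \<forall>i\<in>{1..n}. \<kappa> X i \<in> (\<lambda>X. \<kappa> X i) ` m} = {X. \<forall>i\<in>{1..n}. \<kappa> X i \<in> (\<lambda>X. \<kappa> X i) ` m}"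
proof (rule L.subgroup_image_eqI[OF G _ \<open>g \<in> G\<close>])
  fix g assume g: "g \<in> G"
  then have "g \<in> carrier (Aut L)" using G by (auto simp: L.subgroup_Aut_iff)
  then obtain gs \<pi> where "aut_components S n \<kappa> g gs \<pi>" using Aut_components_exist by blast
  note D = aut_componentsD[OF this]
  have "\<kappa> (g X) i \<in> (\<lambda>X. \<kappa> X i) ` m"
    if X: "\<forall>i\<in>{1..n}. \<kappa> X i \<in> (\<lambda>X. \<kappa> X i) ` m" and i: "i \<in> {1..n}" for X i
  proof -
    obtain X' where X': "X' \<in> m" "\<kappa> X (\<pi> i) = \<kappa> X' (\<pi> i)" using X D(4)[OF i] by blast
    then have "\<kappa> (g X) i = \<kappa> (g X') i" using D(3)[OF i] by simp
    moreover have "g X' \<in> m" using inv[OF g] X'(1) by blast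
    ultimately show ?thesis by blast
  qed
  then show "g ` {X. \<forall>i\<in>{1..n}. \<kappa> X i \<in> (\<lambda>X. \<kappa> X i) ` m} \<subseteq> {X. \<forall>i\<in>{1..n}. \<kappa> X i \<in> (\<lambda>X. \<kappa> X i) ` m}"
    by blast
qed

text \<open>Modulo inner automorphisms, which affect neither the permutation nor the classes of the
  components, every element of the twisted \<open>\<Sigma>\<close> is represented by a conjugate of an element of the
  stabilizer of \<open>m\<close>.\<close>

lemma twist_Sigma_components:
  assumes "subgroup \<Sigma> (Out L)" "Sigma_invariant L \<Sigma> m" "\<Phi> \<in> carrier (Aut L)"
    and "\<sigma> \<in> twist_Sigma L \<Phi> \<Sigma>" "out_components L S n \<kappa> \<sigma> \<sigma>s \<pi>"
  obtains g gs where "g \<in> Aut_over_stab L \<Sigma> m"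
    "aut_components S n \<kappa> (\<Phi> \<circ> g \<circ> Hilbert_Choice.inv \<Phi>) gs \<pi>"
    "\<And>i. i \<in> {1..n} \<Longrightarrow> \<sigma>s i = out_class S (gs i)"
proof -
  obtain \<phi> \<phi>s where \<phi>: "\<phi> \<in> carrier (Aut L)" "aut_components S n \<kappa> \<phi> \<phi>s \<pi>"
    "\<sigma> = out_class L \<phi>" "\<forall>i\<in>{1..n}. \<sigma>s i = out_class S (\<phi>s i)"
    using assms(5) unfolding out_components_def by blast
  obtain u g where ug: "u \<in> Inn L" "g \<in> Aut_over_stab L \<Sigma> m" "\<Phi> \<circ> g \<circ> Hilbert_Choice.inv \<Phi> = u \<circ> \<phi>"
    using L.twist_Sigma_decomp[OF assms(1-3) \<phi>(1)] assms(4) \<phi>(3) by metis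
  obtain us where us: "aut_components S n \<kappa> (u \<circ> \<phi>) (\<lambda>i. us i \<circ> \<phi>s i) \<pi>" "\<forall>i\<in>{1..n}. us i \<in> Inn S"
    using Inn_comp_components[OF ug(1) \<phi>(2)] by blast
  have cls: "\<sigma>s i = out_class S (us i \<circ> \<phi>s i)" if "i \<in> {1..n}" for i
    using S.out_class_Inn[of "us i" "\<phi>s i"] us(2) aut_componentsD(2)[OF \<phi>(2) that] \<phi>(4) that by simp
  have "aut_components S n \<kappa> (\<Phi> \<circ> g \<circ> Hilbert_Choice.inv \<Phi>) (\<lambda>i. us i \<circ> \<phi>s i) \<pi>"
    unfolding ug(3) by (rule us(1))
  then show ?thesis using cls by (rule that[OF ug(2)])
qed

lemma conj_out_components:
  assumes "subgroup \<Sigma> (Out L)" "\<Phi> \<in> carrier (Aut L)" "g \<in> Aut_over_stab L \<Sigma> m"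
    and "aut_components S n \<kappa> (\<Phi> \<circ> g \<circ> Hilbert_Choice.inv \<Phi>) gs \<pi>"
  shows "\<exists>\<sigma>\<in>twist_Sigma L \<Phi> \<Sigma>. out_components L S n \<kappa> \<sigma> (\<lambda>i. out_class S (gs i)) \<pi>"
proof -
  have g: "g \<in> Aut_over L \<Sigma>" using assms(3) by (simp add: Aut_over_stab_def)
  have "\<Phi> \<circ> g \<circ> Hilbert_Choice.inv \<Phi> \<in> carrier (Aut L)"
    by (intro L.Aut_comp L.Aut_inv assms L.Aut_over_Aut[OF g])
  then show ?thesis
    using L.twist_Sigma_conj[OF assms(1,2) g] assms(4) unfolding out_components_def by blast
qed

lemma simple_type_of_product:
  assumes \<Sigma>: "subgroup \<Sigma> (Out L)" "Sigma_simple L \<Sigma>" and prim: "Sigma_primitive L \<Sigma> m" and n: "0 < n"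
    and prod: "\<And>X. (\<And>i. i \<in> {1..n} \<Longrightarrow> \<kappa> X i \<in> (\<lambda>X. \<kappa> X i) ` m) \<Longrightarrow> X \<in> m"
  shows "simple_type L S n \<kappa> \<Sigma> m"
proof -
  let ?G = "Aut_over_stab L \<Sigma> m"
  have inv: "Sigma_invariant L \<Sigma> m" using prim by (simp add: Sigma_primitive_def)
  have G: "subgroup ?G (Aut L)" by (rule L.Aut_over_stab_subgroup[OF \<Sigma>(1)])
  have max: "L.maximal_invariant ?G m" by (rule L.Sigma_primitive_maximal_invariant[OF prim])
  obtain \<Phi> ms where \<Phi>: "\<Phi> \<in> carrier (Aut L)" "\<Phi> ` m = copies_sum n \<kappa> ms"
    and link: "\<And>i. i \<in> {1..n} \<Longrightarrow> \<exists>g\<in>?G. \<exists>hs \<pi>.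
       aut_components S n \<kappa> (\<Phi> \<circ> g \<circ> Hilbert_Choice.inv \<Phi>) hs \<pi> \<and> \<pi> 1 = i \<and> hs 1 = id"
    using product_normal_form[OF n Sigma_invariant_transitive[OF \<Sigma> inv] L.maximal_invariantD(3)[OF max] G prod]
    by blast
  define G' where "G' = (\<lambda>g. \<Phi> \<circ> g \<circ> Hilbert_Choice.inv \<Phi>) ` ?G"
  have G': "subgroup G' (Aut L)" unfolding G'_def by (rule L.subgroup_conj[OF G \<Phi>(1)])
  have max': "L.maximal_invariant G' (copies_sum n \<kappa> ms)"
    using L.maximal_invariant_conj[OF _ max \<Phi>(1)] G \<Phi>(2) unfolding G'_def L.subgroup_Aut_iff by simp
  have link': "\<exists>h\<in>G'. \<exists>hs \<pi>. aut_components S n \<kappa> h hs \<pi> \<and> \<pi> 1 = i \<and> hs 1 = id"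
    if "i \<in> {1..n}" for i
    using link[OF that] unfolding G'_def by blast
  note hyps = n G' max' link'
  define T where "T = induced G' 1"
  have T: "subgroup T (Aut S)" "S.maximal_invariant T ms"
    unfolding T_def using induced_subgroup[OF hyps] induced_maximal_invariant[OF hyps] by blast+
  define \<Sigma>s where "\<Sigma>s = out_class S ` T"
  have sub: "subgroup \<Sigma>s (Out S)"
    unfolding \<Sigma>s_def by (rule group_hom.subgroup_img_is_subgroup[OF S.out_class_hom T(1)])
  have proj: "Sigma_proj L S n \<kappa> (twist_Sigma L \<Phi> \<Sigma>) i = \<Sigma>s" if i: "i \<in> {1..n}" for i
  proof -
    have Ti: "induced G' i = T" unfolding T_def by (rule induced_eq[OF hyps i])
    have into: "\<sigma>s i \<in> \<Sigma>s"
      if c: "\<sigma> \<in> twist_Sigma L \<Phi> \<Sigma>" "out_components L S n \<kappa> \<sigma> \<sigma>s \<pi>" "\<pi> i = i" for \<sigma> \<sigma>s \<pi>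
    proof -
      obtain g gs where g: "g \<in> ?G" "aut_components S n \<kappa> (\<Phi> \<circ> g \<circ> Hilbert_Choice.inv \<Phi>) gs \<pi>"
        "\<And>i. i \<in> {1..n} \<Longrightarrow> \<sigma>s i = out_class S (gs i)"
        by (rule twist_Sigma_components[OF \<Sigma>(1) inv \<Phi>(1) c(1,2)]) blast
      have "gs i \<in> T" using inducedI[OF g(2), of G' i] g(1) c(3) Ti unfolding G'_def by blast
      then show ?thesis unfolding \<Sigma>s_def g(3)[OF i] by blast
    qed
    have onto: "\<exists>\<sigma> \<sigma>s \<pi>. out_class S t = \<sigma>s i \<and> \<sigma> \<in> twist_Sigma L \<Phi> \<Sigma> \<and>
        out_components L S n \<kappa> \<sigma> \<sigma>s \<pi> \<and> \<pi> i = i" if "t \<in> T" for t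
    proof -
      have "t \<in> induced G' i" using that Ti by simp
      then obtain g' gs \<pi> where g: "g' \<in> G'" "aut_components S n \<kappa> g' gs \<pi>" "\<pi> i = i" "t = gs i"
        by (rule inducedE)
      from g(1) obtain h where h: "h \<in> ?G" "g' = \<Phi> \<circ> h \<circ> Hilbert_Choice.inv \<Phi>"
        unfolding G'_def by blast
      obtain \<sigma> where "\<sigma> \<in> twist_Sigma L \<Phi> \<Sigma>" "out_components L S n \<kappa> \<sigma> (\<lambda>i. out_class S (gs i)) \<pi>"
        using conj_out_components[OF \<Sigma>(1) \<Phi>(1) h(1) g(2)[unfolded h(2)]] by blast
      with g(3,4) show ?thesis
        by (intro exI[of _ \<sigma>] exI[of _ "\<lambda>i. out_class S (gs i)"] exI[of _ \<pi>]) simp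
    qed
    show ?thesis
    proof (intro equalityI subsetI)
      fix x assume "x \<in> Sigma_proj L S n \<kappa> (twist_Sigma L \<Phi> \<Sigma>) i"
      then show "x \<in> \<Sigma>s" unfolding Sigma_proj_def using into by fast
    next
      fix x assume "x \<in> \<Sigma>s"
      then obtain t where "t \<in> T" "x = out_class S t" unfolding \<Sigma>s_def by blast
      then show "x \<in> Sigma_proj L S n \<kappa> (twist_Sigma L \<Phi> \<Sigma>) i"
        unfolding Sigma_proj_def mem_Collect_eq using onto by simp
    qed
  qed
  have stab: "T \<subseteq> Aut_over_stab S \<Sigma>s ms"
    using T S.maximal_invariantD(3)[OF T(2)]
    unfolding Aut_over_stab_def Aut_over_def S.subgroup_Aut_iff \<Sigma>s_def by blast
  have "Sigma_primitive S \<Sigma>s ms"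
    unfolding Sigma_primitive_def
  proof (intro conjI allI impI)
    show "lie_subalgebra S ms" "ms \<noteq> UNIV" by (rule S.maximal_invariantD[OF T(2)])+
    show "Sigma_invariant S \<Sigma>s ms"
      unfolding Sigma_invariant_def
    proof
      show "out_class S ` Aut_over_stab S \<Sigma>s ms \<subseteq> \<Sigma>s" by (auto simp: Aut_over_stab_def Aut_over_def)
      show "\<Sigma>s \<subseteq> out_class S ` Aut_over_stab S \<Sigma>s ms"
        using image_mono[OF stab, of "out_class S"] by (simp only: \<Sigma>s_def)
    qed
    show "I = {0} \<or> I = UNIV" if "lie_ideal S I \<and> Sigma_invariant S \<Sigma>s I \<and> I \<subseteq> ms" for I
      using that simple unfolding lie_simple_def by blast
    show "m' = ms \<or> m' = UNIV"
      if "lie_subalgebra S m' \<and> (\<forall>\<phi>\<in>Aut_over_stab S \<Sigma>s ms. \<phi> ` m' = m') \<and> ms \<subseteq> m'" for m'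
      using S.maximal_invariantD(4)[OF T(2), of m'] that stab by blast
  qed
  then show ?thesis unfolding simple_type_def using \<Phi> sub proj by blast
qed

lemma diagonal_type_of_subdirect:
  assumes \<Sigma>: "subgroup \<Sigma> (Out L)" "Sigma_simple L \<Sigma>" and prim: "Sigma_primitive L \<Sigma> m" and n: "0 < n"
    and onto: "\<And>i. i \<in> {1..n} \<Longrightarrow> (\<lambda>X. \<kappa> X i) ` m = UNIV"
  shows "diagonal_type L S n \<kappa> \<Sigma> m"
proof -
  let ?G = "Aut_over_stab L \<Sigma> m"
  have inv: "Sigma_invariant L \<Sigma> m" using prim by (simp add: Sigma_primitive_def)
  have G: "subgroup ?G (Aut L)" by (rule L.Aut_over_stab_subgroup[OF \<Sigma>(1)])
  have max: "L.maximal_invariant ?G m" by (rule L.Sigma_primitive_maximal_invariant[OF prim])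
  note M = L.maximal_invariantD[OF max]
  obtain \<Phi> p q where \<Phi>: "\<Phi> \<in> carrier (Aut L)" "p * q = n" "1 < p" "\<Phi> ` m = diag_sum p q \<kappa>"
    using diagonal_normal_form[OF n Sigma_invariant_transitive[OF \<Sigma> inv] M(3) M(1) M(2) onto] by blast
  define G' where "G' = (\<lambda>g. \<Phi> \<circ> g \<circ> Hilbert_Choice.inv \<Phi>) ` ?G"
  have G': "subgroup G' (Aut L)" unfolding G'_def by (rule L.subgroup_conj[OF G \<Phi>(1)])
  have max': "L.maximal_invariant G' (diag_sum p q \<kappa>)"
    using L.maximal_invariant_conj[OF _ max \<Phi>(1)] G \<Phi>(4) unfolding G'_def L.subgroup_Aut_iff by simp
  have p: "0 < p" and q: "0 < q" using \<Phi>(2) n by (auto intro: Nat.gr0I)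
  have "q < n" using \<Phi>(2,3) q by auto
  moreover have "Sigma_invariant_partition L S n \<kappa> (twist_Sigma L \<Phi> \<Sigma>) (block p ` {..<q})"
    unfolding Sigma_invariant_partition_def
  proof (intro ballI allI impI)
    fix \<sigma> \<sigma>s \<pi> B
    assume c: "\<sigma> \<in> twist_Sigma L \<Phi> \<Sigma>" "out_components L S n \<kappa> \<sigma> \<sigma>s \<pi>" and B: "B \<in> block p ` {..<q}"
    obtain g gs where g: "g \<in> ?G" "aut_components S n \<kappa> (\<Phi> \<circ> g \<circ> Hilbert_Choice.inv \<Phi>) gs \<pi>"
      by (rule twist_Sigma_components[OF \<Sigma>(1) inv \<Phi>(1) c]) blast
    have "\<Phi> \<circ> g \<circ> Hilbert_Choice.inv \<Phi> \<in> G'" unfolding G'_def using g(1) by blast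
    from diag_sum_block_image[OF \<Phi>(2) p L.maximal_invariantD(3)[OF max' this] g(2) B]
    show "\<pi> ` B \<in> block p ` {..<q}" .
  qed
  moreover have "p \<le> p' \<and> q' \<le> q"
    if p': "p' * q' = n" "p' > 1" "q' < n"
      "Sigma_invariant_partition L S n \<kappa> (twist_Sigma L \<Phi> \<Sigma>) (block p' ` {..<q'})" for p' q'
  proof -
    have "\<pi> ` B \<in> block p' ` {..<q'}"
      if "g \<in> G'" and gc: "aut_components S n \<kappa> g gs \<pi>" and B: "B \<in> block p' ` {..<q'}" for g gs \<pi> B
    proof -
      obtain h where h: "h \<in> ?G" "g = \<Phi> \<circ> h \<circ> Hilbert_Choice.inv \<Phi>"
        using \<open>g \<in> G'\<close> unfolding G'_def by blast
      obtain \<sigma> where "\<sigma> \<in> twist_Sigma L \<Phi> \<Sigma>" "out_components L S n \<kappa> \<sigma> (\<lambda>i. out_class S (gs i)) \<pi>"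
        using conj_out_components[OF \<Sigma>(1) \<Phi>(1) h(1) gc[unfolded h(2)]] by blast
      with p'(4) B show ?thesis unfolding Sigma_invariant_partition_def by blast
    qed
    with diag_sum_block_minimal[OF \<Phi>(2,3) n G' max' p'(1,2)] have le: "p \<le> p'" by blast
    moreover have "q' \<le> q"
    proof (rule ccontr)
      assume "\<not> q' \<le> q"
      then have "p * q < p * q'" using p by simp
      also have "\<dots> \<le> p' * q'" using le by simp
      finally show False using \<Phi>(2) p'(1) by simp
    qed
    ultimately show ?thesis ..
  qed
  ultimately show ?thesis unfolding diagonal_type_def using \<Phi> by blast
qed

lemma simple_or_diagonal_type:
  assumes \<Sigma>: "subgroup \<Sigma> (Out L)" "Sigma_simple L \<Sigma>" and prim: "Sigma_primitive L \<Sigma> m"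
  shows "simple_type L S n \<kappa> \<Sigma> m \<or> diagonal_type L S n \<kappa> \<Sigma> m"
proof -
  let ?G = "Aut_over_stab L \<Sigma> m"
  let ?M = "{X. \<forall>i\<in>{1..n}. \<kappa> X i \<in> (\<lambda>X. \<kappa> X i) ` m}"
  have n: "0 < n"
  proof (rule ccontr)
    assume "\<not> 0 < n"
    then have "brac L X Y = 0" for X Y by (intro \<kappa>_eqI) auto
    with \<Sigma>(2) show False by (simp add: Sigma_simple_def lie_abelian_def)
  qed
  have G: "subgroup ?G (Aut L)" by (rule L.Aut_over_stab_subgroup[OF \<Sigma>(1)])
  note M = L.maximal_invariantD[OF L.Sigma_primitive_maximal_invariant[OF prim]]
  have "m \<subseteq> ?M" by blast
  then have "?M = m \<or> ?M = UNIV"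
    by (intro M(4) projections_subalgebra[OF M(1)] projections_invariant[OF G M(3)])
  then show ?thesis
  proof
    assume "?M = m"
    then have "X \<in> m" if "\<And>i. i \<in> {1..n} \<Longrightarrow> \<kappa> X i \<in> (\<lambda>X. \<kappa> X i) ` m" for X using that by blast
    then show ?thesis using simple_type_of_product[OF \<Sigma> prim n] by blast
  next
    assume U: "?M = UNIV"
    have "(\<lambda>X. \<kappa> X i) ` m = UNIV" if i: "i \<in> {1..n}" for i
    proof -
      have "s \<in> (\<lambda>X. \<kappa> X i) ` m" for s
      proof -
        have "tuple (\<lambda>_. s) \<in> ?M" using U by blast
        then have "\<kappa> (tuple (\<lambda>_. s)) i \<in> (\<lambda>X. \<kappa> X i) ` m" using i by blast
        then show ?thesis using i by simp
      qed
      then show ?thesis by blast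
    qed
    then show ?thesis using diagonal_type_of_subdirect[OF \<Sigma> prim n] by blast
  qed
qed

end

theorem theorem5p8:
  fixes L :: "('k::real_normed_field, 'a::euclidean_space) lie_struct"
    and S :: "('k, 'b::euclidean_space) lie_struct"
    and \<Sigma> :: "('a \<Rightarrow> 'a) set set"
    and \<kappa> :: "'a \<Rightarrow> nat \<Rightarrow> 'b"
    and n :: nat
    and m :: "'a set"
  assumes "lie_algebra L"
    and "subgroup \<Sigma> (Out L)"
    and "Sigma_simple L \<Sigma>"
    and "lie_algebra S" and "lie_simple S"
    and "direct_power L S n \<kappa>"
    and "Sigma_primitive L \<Sigma> m"
  shows "simple_type L S n \<kappa> \<Sigma> m \<or> diagonal_type L S n \<kappa> \<Sigma> m"
proof -
  have "lie_power L S n \<kappa>"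
    using assms by (simp add: lie_power_def lie_power_axioms_def)
  then show ?thesis using assms(2,3,7) by (rule lie_power.simple_or_diagonal_type)
qed

end
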